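(* Let $\mathcal{X}\subset H(\mathbb{D})$ be a Banach space containing the constant functions and satisfying conditions (I)-(V) listed in the context. Let $g\in H(\mathbb{D})$ and let $\varphi\colon\mathbb{D}\to\mathbb{D}$ be analytic. (i) If the weight $v$ is normal and $T_g^\varphi\colon\mathcal{X}\to H_v^\infty$ is bounded, then $$\|T_g^\varphi\|_{e,\mathcal{X}\to H_v^\infty}\asymp\limsup_{|\varphi(z)|\to1}(1-|z|)v(z)|(g\circ\varphi)'(z)|\,\|\delta_{\varphi(z)}\|_{\mathcal{X}\to\mathbb{C}}.$$ (ii) For any weight $v$, if $T_g^\varphi\colon\mathcal{X}\to\mathcal{B}_v^\infty$ is bounded, then $$\|T_g^\varphi\|_{e,\mathcal{X}\to\mathcal{B}_v^\infty}\asymp\limsup_{|\varphi(z)|\to1}v(z)|(g\circ\varphi)'(z)|\,\|\delta_{\varphi(z)}\|_{\mathcal{X}\to\mathbb{C}}.$$ In both cases the constants are independent of $g$ and $\varphi$.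
   Context: $\mathbb{D}$ is the open unit disc and $H(\mathbb{D})$ the space of analytic functions on $\mathbb{D}$. The generalized Volterra operator is $T_g^\varphi(f)(z)=\int_0^{\varphi(z)}f(\xi)g'(\xi)\,d\xi$. $\delta_z(f)=f(z)$ is the evaluation functional. Conditions on $\mathcal{X}$: (I) the closed unit ball of $\mathcal{X}$ is compact in the compact open topology; (II) $\lim_{|z|\to1}\|\delta_z\|_{\mathcal{X}\to\mathbb{C}}=\infty$; (III) for every $0<r<1$ the operator $T_r\colon\mathcal{X}\to\mathcal{X}$, $T_rf=f_r$ with $f_r(z)=f(rz)$, is compact; (IV) $\sup_{0<r<1}\|T_r\|_{\mathcal{X}\to\mathcal{X}}<\infty$; (V) for every $u\in H^\infty$ (bounded analytic functions with supremum norm) the multiplication operator $M_u f=uf$ maps $\mathcal{X}$ to $\mathcal{X}$ with $\|M_u\|_{\mathcal{X}\to\mathcal{X}}\le c\|u\|_\infty$, $c$ independent of $u$; in particular $H^\infty\subset\mathcal{X}$. A weight is a continuous strictly positive function $v\colon\mathbb{D}\to\mathbb{R}$ with $\lim_{|z|\to1}v(z)=0$. It is normal if $v(z)=v(|z|)$ for all $z$, $v$ is non-increasing in $|z|$, $\inf_{k\in\mathbb{N}}\limsup_{n\to\infty}\frac{v(1-2^{-n-k})}{v(1-2^{-n})}<1$ and $\sup_{n\in\mathbb{N}}\frac{v(1-2^{-n})}{v(1-2^{-n-1})}<\infty$. $H_v^\infty=\{f\in H(\mathbb{D}):\|f\|_{H_v^\infty}=\sup_{z}v(z)|f(z)|<\infty\}$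 and $\mathcal{B}_v^\infty=\{f\in H(\mathbb{D}):\|f\|_{\mathcal{B}_v^\infty}=|f(0)|+\sup_z v(z)|f'(z)|<\infty\}$. The essential norm of a bounded linear operator $T\colon\mathcal{X}\to\mathcal{Y}$ is $\|T\|_{e,\mathcal{X}\to\mathcal{Y}}=\inf\{\|T-K\|_{\mathcal{X}\to\mathcal{Y}}:K\colon\mathcal{X}\to\mathcal{Y}\text{ compact}\}$. $\limsup_{|\varphi(z)|\to1}F(z)$ means $\lim_{s\to1^-}\sup_{|\varphi(z)|>s}F(z)$, with the supremum over the empty set equal to $0$. $A\asymp B$ means $c^{-1}B\le A\le cB$ for a constant $c>0$. *)

theory Defs
  imports "HOL-Complex_Analysis.Complex_Analysis"
begin

section \<open>Functions on the unit disc\<close>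

abbreviation unit_disc :: "complex set" where
  "unit_disc \<equiv> ball 0 1"

text \<open>Elements of function spaces on the disc are represented by functions on the whole plane
  that vanish off the disc, so that equality of representatives is equality on the disc.\<close>

definition on_disc :: "(complex \<Rightarrow> complex) \<Rightarrow> complex \<Rightarrow> complex" where
  "on_disc f = (\<lambda>z. if z \<in> unit_disc then f z else 0)"

definition Hol_disc :: "(complex \<Rightarrow> complex) set" where
  "Hol_disc = {f. f holomorphic_on unit_disc \<and> (\<forall>z. z \<notin> unit_disc \<longrightarrow> f z = 0)}"

definition compact_open_topology :: "(complex \<Rightarrow> complex) topology" where
  "compact_open_topology =
     topology_generated_by
       {{f \<in> Hol_disc. f ` K \<subseteq> U} | K U. compact K \<and> K \<subseteq> unit_disc \<and> open U}"

text \<open>The filter \<open>|z| \<rightarrow> 1\<close> within the disc.\<close>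

abbreviation to_circle :: "complex filter" where
  "to_circle \<equiv> filtercomap cmod (at_left 1)"


section \<open>Complex normed spaces of functions and their operators\<close>

definition normed_space_on_disc ::
    "(complex \<Rightarrow> complex) set \<Rightarrow> ((complex \<Rightarrow> complex) \<Rightarrow> real) \<Rightarrow> bool" where
  "normed_space_on_disc X N \<longleftrightarrow>
     X \<subseteq> Hol_disc \<and>
     (\<lambda>z. 0) \<in> X \<and>
     (\<forall>f\<in>X. \<forall>g\<in>X. (\<lambda>z. f z + g z) \<in> X) \<and>
     (\<forall>a. \<forall>f\<in>X. (\<lambda>z. a * f z) \<in> X) \<and>
     (\<forall>f\<in>X. 0 \<le> N f) \<and>
     (\<forall>f\<in>X. N f = 0 \<longleftrightarrow> f = (\<lambda>z. 0)) \<and>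
     (\<forall>a. \<forall>f\<in>X. N (\<lambda>z. a * f z) = cmod a * N f) \<and>
     (\<forall>f\<in>X. \<forall>g\<in>X. N (\<lambda>z. f z + g z) \<le> N f + N g)"

text \<open>The case distinction is needed because \<^locale>\<open>Metric_space\<close> requires symmetry and
  nonnegativity on the whole type.\<close>

definition norm_dist ::
    "('a \<Rightarrow> complex) set \<Rightarrow> (('a \<Rightarrow> complex) \<Rightarrow> real) \<Rightarrow>
     ('a \<Rightarrow> complex) \<Rightarrow> ('a \<Rightarrow> complex) \<Rightarrow> real" where
  "norm_dist X N f g = (if f \<in> X \<and> g \<in> X then N (\<lambda>z. f z - g z) else 0)"

definition norm_metric ::
    "('a \<Rightarrow> complex) set \<Rightarrow> (('a \<Rightarrow> complex) \<Rightarrow> real) \<Rightarrow> ('a \<Rightarrow> complex) metric" where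
  "norm_metric X N = metric (X, norm_dist X N)"

definition banach_space_on_disc ::
    "(complex \<Rightarrow> complex) set \<Rightarrow> ((complex \<Rightarrow> complex) \<Rightarrow> real) \<Rightarrow> bool" where
  "banach_space_on_disc X N \<longleftrightarrow> normed_space_on_disc X N \<and> mcomplete_of (norm_metric X N)"

abbreviation unit_ball :: "'a set \<Rightarrow> ('a \<Rightarrow> real) \<Rightarrow> 'a set" where
  "unit_ball X N \<equiv> {f \<in> X. N f \<le> 1}"

definition op_norm :: "'a set \<Rightarrow> ('a \<Rightarrow> real) \<Rightarrow> ('b \<Rightarrow> real) \<Rightarrow> ('a \<Rightarrow> 'b) \<Rightarrow> ennreal" where
  "op_norm X N M T = (SUP f\<in>unit_ball X N. ennreal (M (T f)))"

abbreviation eval_norm ::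
    "(complex \<Rightarrow> complex) set \<Rightarrow> ((complex \<Rightarrow> complex) \<Rightarrow> real) \<Rightarrow> complex \<Rightarrow> ennreal" where
  "eval_norm X N z \<equiv> op_norm X N cmod (\<lambda>f. f z)"

definition linear_operator ::
    "('a \<Rightarrow> complex) set \<Rightarrow> ('b \<Rightarrow> complex) set \<Rightarrow> (('a \<Rightarrow> complex) \<Rightarrow> ('b \<Rightarrow> complex)) \<Rightarrow> bool" where
  "linear_operator X Y T \<longleftrightarrow>
     T ` X \<subseteq> Y \<and>
     (\<forall>f\<in>X. \<forall>g\<in>X. T (\<lambda>z. f z + g z) = (\<lambda>z. T f z + T g z)) \<and>
     (\<forall>a. \<forall>f\<in>X. T (\<lambda>z. a * f z) = (\<lambda>z. a * T f z))"

definition bounded_operator ::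
    "('a \<Rightarrow> complex) set \<Rightarrow> (('a \<Rightarrow> complex) \<Rightarrow> real) \<Rightarrow>
     ('b \<Rightarrow> complex) set \<Rightarrow> (('b \<Rightarrow> complex) \<Rightarrow> real) \<Rightarrow>
     (('a \<Rightarrow> complex) \<Rightarrow> ('b \<Rightarrow> complex)) \<Rightarrow> bool" where
  "bounded_operator X N Y M T \<longleftrightarrow> linear_operator X Y T \<and> op_norm X N M T < \<infinity>"

definition compact_operator ::
    "('a \<Rightarrow> complex) set \<Rightarrow> (('a \<Rightarrow> complex) \<Rightarrow> real) \<Rightarrow>
     ('b \<Rightarrow> complex) set \<Rightarrow> (('b \<Rightarrow> complex) \<Rightarrow> real) \<Rightarrow>
     (('a \<Rightarrow> complex) \<Rightarrow> ('b \<Rightarrow> complex)) \<Rightarrow> bool" where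
  "compact_operator X N Y M T \<longleftrightarrow>
     linear_operator X Y T \<and>
     compactin (mtopology_of (norm_metric Y M))
       (mtopology_of (norm_metric Y M) closure_of (T ` unit_ball X N))"

definition essential_norm ::
    "('a \<Rightarrow> complex) set \<Rightarrow> (('a \<Rightarrow> complex) \<Rightarrow> real) \<Rightarrow>
     ('b \<Rightarrow> complex) set \<Rightarrow> (('b \<Rightarrow> complex) \<Rightarrow> real) \<Rightarrow>
     (('a \<Rightarrow> complex) \<Rightarrow> ('b \<Rightarrow> complex)) \<Rightarrow> ennreal" where
  "essential_norm X N Y M T =
     (INF K\<in>{K. compact_operator X N Y M K}. op_norm X N M (\<lambda>f z. T f z - K f z))"


section \<open>Weights and the target spaces\<close>

definition weight :: "(complex \<Rightarrow> real) \<Rightarrow> bool" where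
  "weight v \<longleftrightarrow> continuous_on unit_disc v \<and> (\<forall>z\<in>unit_disc. 0 < v z) \<and> (v \<longlongrightarrow> 0) to_circle"

definition normal_weight :: "(complex \<Rightarrow> real) \<Rightarrow> bool" where
  "normal_weight v \<longleftrightarrow>
     weight v \<and>
     (\<forall>z\<in>unit_disc. v z = v (of_real (cmod z))) \<and>
     (\<forall>z\<in>unit_disc. \<forall>w\<in>unit_disc. cmod z \<le> cmod w \<longrightarrow> v w \<le> v z) \<and>
     (INF k::nat. limsup (\<lambda>n. ennreal (v (1 - 1 / 2 ^ (n + k)) / v (1 - 1 / 2 ^ n)))) < 1 \<and>
     (SUP n::nat. ennreal (v (1 - 1 / 2 ^ n) / v (1 - 1 / 2 ^ (n + 1)))) < \<infinity>"

definition Hv :: "(complex \<Rightarrow> real) \<Rightarrow> (complex \<Rightarrow> complex) set" where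
  "Hv v = {f \<in> Hol_disc. bdd_above ((\<lambda>z. v z * cmod (f z)) ` unit_disc)}"

definition norm_Hv :: "(complex \<Rightarrow> real) \<Rightarrow> (complex \<Rightarrow> complex) \<Rightarrow> real" where
  "norm_Hv v f = (SUP z\<in>unit_disc. v z * cmod (f z))"

definition Bv :: "(complex \<Rightarrow> real) \<Rightarrow> (complex \<Rightarrow> complex) set" where
  "Bv v = {f \<in> Hol_disc. bdd_above ((\<lambda>z. v z * cmod (deriv f z)) ` unit_disc)}"

definition norm_Bv :: "(complex \<Rightarrow> real) \<Rightarrow> (complex \<Rightarrow> complex) \<Rightarrow> real" where
  "norm_Bv v f = cmod (f 0) + (SUP z\<in>unit_disc. v z * cmod (deriv f z))"


section \<open>The conditions on the space \<open>X\<close>\<close>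

definition dilation :: "real \<Rightarrow> (complex \<Rightarrow> complex) \<Rightarrow> complex \<Rightarrow> complex" where
  "dilation r f = on_disc (\<lambda>z. f (of_real r * z))"

definition Hinf :: "(complex \<Rightarrow> complex) set" where
  "Hinf = {u \<in> Hol_disc. bounded (u ` unit_disc)}"

definition norm_Hinf :: "(complex \<Rightarrow> complex) \<Rightarrow> real" where
  "norm_Hinf u = (SUP z\<in>unit_disc. cmod (u z))"

definition condI :: "(complex \<Rightarrow> complex) set \<Rightarrow> ((complex \<Rightarrow> complex) \<Rightarrow> real) \<Rightarrow> bool" where
  "condI X N \<longleftrightarrow> compactin compact_open_topology (unit_ball X N)"

definition condII :: "(complex \<Rightarrow> complex) set \<Rightarrow> ((complex \<Rightarrow> complex) \<Rightarrow> real) \<Rightarrow> bool" where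
  "condII X N \<longleftrightarrow> ((\<lambda>z. eval_norm X N z) \<longlongrightarrow> \<infinity>) to_circle"

definition condIII :: "(complex \<Rightarrow> complex) set \<Rightarrow> ((complex \<Rightarrow> complex) \<Rightarrow> real) \<Rightarrow> bool" where
  "condIII X N \<longleftrightarrow> (\<forall>r. 0 < r \<and> r < 1 \<longrightarrow> compact_operator X N X N (dilation r))"

definition condIV :: "(complex \<Rightarrow> complex) set \<Rightarrow> ((complex \<Rightarrow> complex) \<Rightarrow> real) \<Rightarrow> bool" where
  "condIV X N \<longleftrightarrow> (SUP r\<in>{0<..<1}. op_norm X N N (dilation r)) < \<infinity>"

definition condV :: "(complex \<Rightarrow> complex) set \<Rightarrow> ((complex \<Rightarrow> complex) \<Rightarrow> real) \<Rightarrow> bool" where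
  "condV X N \<longleftrightarrow>
     (\<exists>c::real. \<forall>u\<in>Hinf.
        (\<forall>f\<in>X. (\<lambda>z. u z * f z) \<in> X) \<and>
        op_norm X N N (\<lambda>f z. u z * f z) \<le> ennreal (c * norm_Hinf u))"


section \<open>The generalized Volterra operator\<close>

definition volterra ::
    "(complex \<Rightarrow> complex) \<Rightarrow> (complex \<Rightarrow> complex) \<Rightarrow> (complex \<Rightarrow> complex) \<Rightarrow> complex \<Rightarrow> complex" where
  "volterra g \<phi> f =
     on_disc (\<lambda>z. contour_integral (linepath 0 (\<phi> z)) (\<lambda>\<xi>. f \<xi> * deriv g \<xi>))"

text \<open>In \<^typ>\<open>ennreal\<close> the supremum of the empty set is \<open>0\<close>. The supremum decreases in \<open>s\<close>, so the
  limit always exists (lemma \<open>limsup_circle_tendsto\<close> below).\<close>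

definition limsup_circle :: "(complex \<Rightarrow> complex) \<Rightarrow> (complex \<Rightarrow> ennreal) \<Rightarrow> ennreal" where
  "limsup_circle \<phi> F = Lim (at_left (1::real)) (\<lambda>s. SUP z\<in>{z \<in> unit_disc. s < cmod (\<phi> z)}. F z)"

definition comparable :: "real \<Rightarrow> ennreal \<Rightarrow> ennreal \<Rightarrow> bool" where
  "comparable c A B \<longleftrightarrow> ennreal (1 / c) * B \<le> A \<and> A \<le> ennreal c * B"


section \<open>The underlying metrics and limits are well defined\<close>

lemma Metric_space_norm_dist:
  assumes "normed_space_on_disc X N"
  shows "Metric_space X (norm_dist X N)"
proof -
  note N = assms[unfolded normed_space_on_disc_def]
  have add: "(\<lambda>z. f z + g z) \<in> X" "N (\<lambda>z. f z + g z) \<le> N f + N g"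
    if "f \<in> X" "g \<in> X" for f g
    using N that by blast+
  have scale: "(\<lambda>z. a * f z) \<in> X" "N (\<lambda>z. a * f z) = cmod a * N f" if "f \<in> X" for a f
    using N that by blast+
  have nonneg: "0 \<le> N f" and zero: "N f = 0 \<longleftrightarrow> f = (\<lambda>z. 0)" if "f \<in> X" for f
    using N that by blast+
  have diff: "(\<lambda>z. f z - g z) \<in> X" if "f \<in> X" "g \<in> X" for f g
    using add(1)[OF that(1) scale(1)[OF that(2), of "-1"]] by simp
  have comm: "N (\<lambda>z. f z - g z) = N (\<lambda>z. g z - f z)" if "f \<in> X" "g \<in> X" for f g
    using scale(2)[OF diff[OF that], of "-1"] by simp
  show ?thesis
  proof
    fix f g show "0 \<le> norm_dist X N f g"
      using nonneg diff by (auto simp: norm_dist_def)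
    show "norm_dist X N f g = norm_dist X N g f"
      using comm by (auto simp: norm_dist_def)
  next
    fix f g assume fg: "f \<in> X" "g \<in> X"
    have "N (\<lambda>z. f z - g z) = 0 \<longleftrightarrow> (\<lambda>z. f z - g z) = (\<lambda>z. 0)"
      by (rule zero[OF diff[OF fg]])
    then show "norm_dist X N f g = 0 \<longleftrightarrow> f = g"
      using fg by (auto simp: norm_dist_def fun_eq_iff)
  next
    fix f g h assume fgh: "f \<in> X" "g \<in> X" "h \<in> X"
    have "N (\<lambda>z. (f z - g z) + (g z - h z)) \<le> N (\<lambda>z. f z - g z) + N (\<lambda>z. g z - h z)"
      using fgh by (intro add(2) diff)
    then show "norm_dist X N f h \<le> norm_dist X N f g + norm_dist X N g h"
      using fgh by (simp add: norm_dist_def)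
  qed
qed

lemma limsup_circle_eq_INF:
  "limsup_circle \<phi> F = (INF s\<in>{..<1}. SUP z\<in>{z \<in> unit_disc. s < cmod (\<phi> z)}. F z)" (is "_ = ?L")
  and limsup_circle_tendsto:
  "((\<lambda>s. SUP z\<in>{z \<in> unit_disc. s < cmod (\<phi> z)}. F z) \<longlongrightarrow> limsup_circle \<phi> F) (at_left 1)"
proof -
  let ?G = "\<lambda>s::real. SUP z\<in>{z \<in> unit_disc. s < cmod (\<phi> z)}. F z"
  have mono: "?G t \<le> ?G s" if "s \<le> t" for s t
    by (rule SUP_subset_mono) (use that in auto)
  have tends: "(?G \<longlongrightarrow> ?L) (at_left 1)"
  proof (rule order_tendstoI)
    fix y assume y: "y < ?L"
    have "eventually (\<lambda>s. s < 1) (at_left (1::real))"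
      by (simp add: eventually_at_filter)
    then show "eventually (\<lambda>s. y < ?G s) (at_left 1)"
    proof eventually_elim
      case (elim s)
      then have "?L \<le> ?G s" by (intro INF_lower) auto
      with y show ?case by (rule less_le_trans)
    qed
  next
    fix y assume "?L < y"
    then obtain s where s: "s < 1" "?G s < y"
      by (auto simp: INF_less_iff)
    have "eventually (\<lambda>t. t \<in> {s<..<1}) (at_left (1::real))"
      using s(1) by (rule eventually_at_left_real)
    then show "eventually (\<lambda>t. ?G t < y) (at_left 1)"
    proof eventually_elim
      case (elim t)
      then have "?G t \<le> ?G s" by (intro mono) auto
      then show ?case using s(2) by (rule le_less_trans)
    qed
  qed
  then show eq: "limsup_circle \<phi> F = ?L"
    unfolding limsup_circle_def by (intro tendsto_Lim) auto
  show "(?G \<longlongrightarrow> limsup_circle \<phi> F) (at_left 1)"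
    using tends by (simp add: eq)
qed

end

theory Submission
  imports Defs
begin

text \<open>
  Write \<open>T\<close> for the generalized Volterra operator. Its essential feature is the identity
  \<open>(T f)' = (f \<circ> \<phi>) (g \<circ> \<phi>)'\<close> (\<open>deriv_volterra\<close>), so everything becomes simple once the norm of the target
  is equivalent to \<open>|h 0| + sup w |h'|\<close> for some \<open>w\<close>. For \<^const>\<open>Bv\<close> this holds by definition with
  \<open>w = v\<close>; for \<^const>\<open>Hv\<close> and a normal weight it holds with \<open>w z = (1 - |z|) v z\<close>, by Cauchy's estimate in
  one direction and by integration over dyadic shells in the other (\<open>weighted_deriv_le_norm_Hv\<close>,
  \<open>norm_Hv_le_weighted_deriv\<close>). Both parts of the theorem are therefore instances of one estimate, proved
  in the locale \<open>volterra_into_derivative_norm\<close>. There \<open>symbol z\<close> is \<open>w z |(g \<circ> \<phi>)' z|\<close>, and \<open>density z\<close>, its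
  product with the norm of the evaluation at \<open>\<phi> z\<close>, is the quantity whose limes superior is to be
  compared with the essential norm.

  For the upper estimate, \<open>T\<close> is approximated by its compositions with the dilations \<open>f \<mapsto> f\<^sub>r\<close>, which
  are compact. On the part of the disc where \<open>|\<phi>| \<le> s\<close> the error tends to \<open>0\<close> as \<open>r \<rightarrow> 1\<close>, because the unit
  ball of \<open>X\<close> is locally bounded and hence equicontinuous on compact sets; on the rest it is at most a
  constant times the supremum of the density.

  For the lower estimate, a compact \<open>K\<close> is tested on differences \<open>e\<^sub>n - e\<^sub>m\<close> of bounded functions that
  are nearly extremal for the evaluations at \<open>\<phi>(z\<^sub>n)\<close>, where \<open>|\<phi>(z\<^sub>n)| \<rightarrow> 1\<close>. Along a subsequence \<open>K\<close> does
  not see these differences, while \<open>T\<close> sees the density at \<open>z\<^sub>n\<close>: the contribution of the fixed bounded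
  function \<open>e\<^sub>m\<close> vanishes because the symbol tends to \<open>0\<close> where the evaluation functionals blow up
  (\<open>limsup_le_op_norm_minus_compact\<close>).
\<close>

section \<open>Normed spaces on the disc and their operators\<close>

lemma normed_space_on_discD:
  assumes "normed_space_on_disc X N"
  shows "X \<subseteq> Hol_disc"
    and "f \<in> X \<Longrightarrow> (\<lambda>z. a * f z) \<in> X"
    and "f \<in> X \<Longrightarrow> h \<in> X \<Longrightarrow> (\<lambda>z. f z + h z) \<in> X"
    and "f \<in> X \<Longrightarrow> 0 \<le> N f"
    and "f \<in> X \<Longrightarrow> N f = 0 \<longleftrightarrow> f = (\<lambda>z. 0)"
    and "f \<in> X \<Longrightarrow> N (\<lambda>z. a * f z) = cmod a * N f"
    and "f \<in> X \<Longrightarrow> h \<in> X \<Longrightarrow> N (\<lambda>z. f z + h z) \<le> N f + N h"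
  using assms unfolding normed_space_on_disc_def by blast+

lemma normed_space_diff:
  assumes X: "normed_space_on_disc X N" and f: "f \<in> X" and h: "h \<in> X"
  shows "(\<lambda>z. f z - h z) \<in> X" and "N (\<lambda>z. f z - h z) \<le> N f + N h"
proof -
  note D = normed_space_on_discD[OF X]
  have m: "(\<lambda>z. (-1) * h z) \<in> X" "N (\<lambda>z. (-1) * h z) = N h"
    using D(2,6)[OF h, of "-1"] by simp_all
  show "(\<lambda>z. f z - h z) \<in> X" using D(3)[OF f m(1)] by simp
  show "N (\<lambda>z. f z - h z) \<le> N f + N h" using D(7)[OF f m(1)] m(2) by simp
qed

lemma linear_operatorD:
  assumes "linear_operator X Y T"
  shows "f \<in> X \<Longrightarrow> T f \<in> Y"
    and "f \<in> X \<Longrightarrow> h \<in> X \<Longrightarrow> T (\<lambda>z. f z + h z) = (\<lambda>z. T f z + T h z)"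
    and "f \<in> X \<Longrightarrow> T (\<lambda>z. a * f z) = (\<lambda>z. a * T f z)"
  using assms unfolding linear_operator_def by blast+

lemma linear_operator_diff:
  assumes X: "normed_space_on_disc X N" and T: "linear_operator X Y T" and f: "f \<in> X" and h: "h \<in> X"
  shows "T (\<lambda>z. f z - h z) = (\<lambda>z. T f z - T h z)"
proof -
  note D = normed_space_on_discD[OF X]
  have "T (\<lambda>z. f z + (-1) * h z) = (\<lambda>z. T f z + (-1) * T h z)"
    using linear_operatorD(2)[OF T f D(2)[OF h, of "-1"]] linear_operatorD(3)[OF T h, of "-1"]
    by simp
  then show ?thesis by simp
qed

lemma linear_operator_minus:
  assumes Y: "normed_space_on_disc Y M" and T: "linear_operator X Y T" and K: "linear_operator X Y K"
  shows "linear_operator X Y (\<lambda>f z. T f z - K f z)"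
  unfolding linear_operator_def
proof (intro conjI ballI allI)
  show "(\<lambda>f z. T f z - K f z) ` X \<subseteq> Y"
    using normed_space_diff(1)[OF Y linear_operatorD(1)[OF T] linear_operatorD(1)[OF K]] by blast
next
  fix f h assume "f \<in> X" "h \<in> X"
  then show "(\<lambda>z. T (\<lambda>z. f z + h z) z - K (\<lambda>z. f z + h z) z)
      = (\<lambda>z. (T f z - K f z) + (T h z - K h z))"
    using linear_operatorD(2)[OF T] linear_operatorD(2)[OF K] by (simp add: algebra_simps)
next
  fix a f assume "f \<in> X"
  then show "(\<lambda>z. T (\<lambda>z. a * f z) z - K (\<lambda>z. a * f z) z) = (\<lambda>z. a * (T f z - K f z))"
    using linear_operatorD(3)[OF T] linear_operatorD(3)[OF K] by (simp add: algebra_simps)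
qed

text \<open>Homogeneity is assumed only for the norm of the image, so that the lemma covers operators
  between function spaces as well as the evaluation functionals.\<close>

lemma op_norm_bound:
  assumes X: "normed_space_on_disc X N"
    and hom: "\<And>a f. f \<in> X \<Longrightarrow> M (T (\<lambda>z. a * f z)) = cmod a * M (T f)"
    and le: "op_norm X N M T \<le> ennreal R" and R: "0 \<le> R" and f: "f \<in> X"
  shows "M (T f) \<le> R * N f"
proof (cases "N f = 0")
  case True
  then have "f = (\<lambda>z. 0 * f z)" using normed_space_on_discD(5)[OF X f] by simp
  then have "M (T f) = 0" using hom[OF f, of 0] by simp
  then show ?thesis using True by simp
next
  case False
  then have pos: "0 < N f" using normed_space_on_discD(4)[OF X f] by simp
  let ?a = "of_real (1 / N f) :: complex"
  have "N (\<lambda>z. ?a * f z) = cmod ?a * N f"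
    by (rule normed_space_on_discD(6)[OF X f])
  also have "\<dots> = 1" using pos by (simp add: norm_divide)
  finally have "(\<lambda>z. ?a * f z) \<in> unit_ball X N"
    using normed_space_on_discD(2)[OF X f, of ?a] by simp
  then have "ennreal (M (T (\<lambda>z. ?a * f z))) \<le> op_norm X N M T"
    unfolding op_norm_def by (rule SUP_upper)
  also note le
  finally have "M (T (\<lambda>z. ?a * f z)) \<le> R" using R by (simp add: ennreal_le_iff)
  then have "1 / N f * M (T f) \<le> R" using hom[OF f, of ?a] pos by (simp add: norm_divide)
  then show ?thesis using pos by (simp add: field_simps)
qed

lemma operator_norm_bound:
  assumes X: "normed_space_on_disc X N" and Y: "normed_space_on_disc Y M"
    and T: "linear_operator X Y T"
    and le: "op_norm X N M T \<le> ennreal R" and R: "0 \<le> R" and f: "f \<in> X"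
  shows "M (T f) \<le> R * N f"
proof (rule op_norm_bound[where M = M and T = T, OF X _ le R f])
  fix a f assume "f \<in> X"
  then show "M (T (\<lambda>z. a * f z)) = cmod a * M (T f)"
    using linear_operatorD(1,3)[OF T] normed_space_on_discD(6)[OF Y] by simp
qed

lemma eval_norm_bound:
  assumes "normed_space_on_disc X N" and "eval_norm X N z \<le> ennreal R" and "0 \<le> R" and "f \<in> X"
  shows "cmod (f z) \<le> R * N f"
  by (rule op_norm_bound[where M = cmod and T = "\<lambda>f. f z", OF assms(1) _ assms(2-4)])
     (simp add: norm_mult)

lemma mtopology_of_norm_metric:
  assumes "normed_space_on_disc Y M"
  shows "mtopology_of (norm_metric Y M) = Metric_space.mtopology Y (norm_dist Y M)"
  unfolding norm_metric_def
  by (rule Metric_space.mtopology_of[OF Metric_space_norm_dist[OF assms]])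

lemma compact_operator_compose:
  assumes X: "normed_space_on_disc X N" and Y: "normed_space_on_disc Y M"
    and T: "bounded_operator X N Y M T" and S: "compact_operator X N X N S"
  shows "compact_operator X N Y M (\<lambda>f. T (S f))"
proof -
  interpret X: Metric_space X "norm_dist X N" by (rule Metric_space_norm_dist[OF X])
  interpret Y: Metric_space Y "norm_dist Y M" by (rule Metric_space_norm_dist[OF Y])
  have linT: "linear_operator X Y T" and "op_norm X N M T < \<infinity>"
    using T by (auto simp: bounded_operator_def)
  then obtain R where R: "0 \<le> R" "op_norm X N M T \<le> ennreal R"
    by (cases "op_norm X N M T") auto
  have linS: "linear_operator X X S"
    and cpt: "compactin X.mtopology (X.mtopology closure_of (S ` unit_ball X N))" (is "compactin _ ?C")
    using S by (auto simp: compact_operator_def mtopology_of_norm_metric[OF X])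
  have lin: "linear_operator X Y (\<lambda>f. T (S f))"
    using linear_operatorD[OF linS] linear_operatorD[OF linT]
    unfolding linear_operator_def by auto
  have cont: "continuous_map X.mtopology Y.mtopology T"
    unfolding X.metric_continuous_map[OF Y.Metric_space_axioms]
  proof (intro conjI ballI allI impI)
    show "T ` X \<subseteq> Y" using linear_operatorD(1)[OF linT] by auto
    fix a and e :: real assume a: "a \<in> X" and e: "0 < e"
    have "norm_dist Y M (T a) (T x) < e" if x: "x \<in> X" "norm_dist X N a x < e / (R + 1)" for x
    proof -
      have "norm_dist Y M (T a) (T x) = M (T (\<lambda>z. a z - x z))"
        using linear_operatorD(1)[OF linT] a x linear_operator_diff[OF X linT a x(1)]
        by (simp add: norm_dist_def)
      also have "\<dots> \<le> R * N (\<lambda>z. a z - x z)"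
        by (rule operator_norm_bound[OF X Y linT R(2,1) normed_space_diff(1)[OF X a x(1)]])
      also have "\<dots> \<le> R * (e / (R + 1))"
        using x a R(1) by (intro mult_left_mono) (auto simp: norm_dist_def)
      also have "\<dots> < e" using R(1) e by (simp add: field_simps)
      finally show ?thesis .
    qed
    then show "\<exists>\<delta>>0. \<forall>x. x \<in> X \<and> norm_dist X N a x < \<delta> \<longrightarrow> norm_dist Y M (T a) (T x) < e"
      using R(1) e by (intro exI[of _ "e / (R + 1)"]) auto
  qed
  have TC: "compactin Y.mtopology (T ` ?C)"
    by (rule image_compactin[OF cpt cont])
  have "S ` unit_ball X N \<subseteq> ?C"
    using linear_operatorD(1)[OF linS] by (intro closure_of_subset) auto
  then have "Y.mtopology closure_of ((\<lambda>f. T (S f)) ` unit_ball X N) \<subseteq> T ` ?C"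
    by (intro closure_of_minimal compactin_imp_closedin[OF Y.Hausdorff_space_mtopology TC]) auto
  then have "compactin Y.mtopology (Y.mtopology closure_of ((\<lambda>f. T (S f)) ` unit_ball X N))"
    by (rule closed_compactin[OF TC]) simp
  with lin show ?thesis
    by (simp add: compact_operator_def mtopology_of_norm_metric[OF Y])
qed

text \<open>The form in which the lower estimate uses compactness: infinitely many images of a
  bounded sequence lie close to one of them, since the images have a convergent subsequence.\<close>

lemma compact_operator_frequently_close:
  assumes Y: "normed_space_on_disc Y M"
    and K: "compact_operator X N Y M K" and f: "\<And>n::nat. f n \<in> unit_ball X N" and e: "0 < e"
  obtains m where "\<exists>\<^sub>F n in sequentially. M (\<lambda>z. K (f n) z - K (f m) z) < e"
proof -
  interpret Y: Metric_space Y "norm_dist Y M" by (rule Metric_space_norm_dist[OF Y])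
  have linK: "linear_operator X Y K"
    and cpt: "compactin Y.mtopology (Y.mtopology closure_of (K ` unit_ball X N))" (is "compactin _ ?C")
    using K by (auto simp: compact_operator_def mtopology_of_norm_metric[OF Y])
  have KY: "K (f n) \<in> Y" for n using linear_operatorD(1)[OF linK] f by auto
  have "K ` unit_ball X N \<subseteq> ?C"
    using linear_operatorD(1)[OF linK] by (intro closure_of_subset) auto
  then have "range (\<lambda>n. K (f n)) \<subseteq> ?C" using f by blast
  then obtain l r where r: "strict_mono (r :: nat \<Rightarrow> nat)"
    and lim: "limitin Y.mtopology ((\<lambda>n. K (f n)) \<circ> r) l sequentially"
    using cpt unfolding Y.compactin_sequentially by blast
  have l: "l \<in> Y" and conv: "\<And>\<epsilon>. \<epsilon> > 0 \<Longrightarrow> \<exists>k. \<forall>n\<ge>k. norm_dist Y M (K (f (r n))) l < \<epsilon>"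
    using lim unfolding Y.limit_metric_sequentially comp_def by blast+
  obtain n0 where n0: "\<And>n. n \<ge> n0 \<Longrightarrow> norm_dist Y M (K (f (r n))) l < e / 2"
    using conv[of "e / 2"] e by auto
  have close: "M (\<lambda>z. K (f (r n)) z - K (f (r n0)) z) < e" if "n \<ge> n0" for n
  proof -
    have "norm_dist Y M (K (f (r n))) (K (f (r n0)))
        \<le> norm_dist Y M (K (f (r n))) l + norm_dist Y M (K (f (r n0))) l"
      by (rule Y.triangle'[OF KY l KY])
    also have "\<dots> < e" using n0[OF that] n0[of n0] by simp
    finally show ?thesis using KY by (simp add: norm_dist_def)
  qed
  have "\<exists>\<^sub>F n in sequentially. M (\<lambda>z. K (f n) z - K (f (r n0)) z) < e"
    unfolding frequently_sequentially
  proof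
    fix k
    have "r (max k n0) \<ge> k" using seq_suble[OF r, of "max k n0"] by simp
    then show "\<exists>n\<ge>k. M (\<lambda>z. K (f n) z - K (f (r n0)) z) < e" using close[of "max k n0"] by auto
  qed
  then show ?thesis by (rule that)
qed


section \<open>Consequences of compactness of the unit ball\<close>

lemma Hol_discD:
  assumes "f \<in> Hol_disc"
  shows "f holomorphic_on unit_disc" and "z \<notin> unit_disc \<Longrightarrow> f z = 0"
  using assms by (auto simp: Hol_disc_def)

lemma condI_imp_locally_bounded:
  assumes X: "normed_space_on_disc X N" and I: "condI X N"
    and K: "compact K" "K \<subseteq> unit_disc"
  shows "\<exists>C\<ge>0. \<forall>f\<in>unit_ball X N. \<forall>z\<in>K. cmod (f z) \<le> C"
proof -
  let ?U = "\<lambda>n::nat. {f \<in> Hol_disc. f ` K \<subseteq> ball 0 (real n)}"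
  have op: "openin compact_open_topology U" if "U \<in> range ?U" for U
    unfolding compact_open_topology_def using that K
    by (intro topology_generated_by_Basis) blast
  have cover: "unit_ball X N \<subseteq> \<Union>(range ?U)"
  proof
    fix f assume "f \<in> unit_ball X N"
    then have f: "f \<in> Hol_disc" using normed_space_on_discD(1)[OF X] by auto
    then have "continuous_on K f"
      using holomorphic_on_imp_continuous_on[OF Hol_discD(1)] continuous_on_subset K(2) by blast
    then have "bounded (f ` K)"
      using compact_continuous_image compact_imp_bounded K(1) by blast
    then obtain b where b: "\<And>z. z \<in> K \<Longrightarrow> cmod (f z) \<le> b" by (auto simp: bounded_iff)
    obtain n :: nat where n: "b < real n" using reals_Archimedean2 by blast
    have "f \<in> ?U n" using f by (auto intro!: le_less_trans[OF b n])
    then show "f \<in> \<Union>(range ?U)" by blast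
  qed
  obtain F where F: "finite F" "F \<subseteq> range ?U" "unit_ball X N \<subseteq> \<Union>F"
    using compactinD[OF I[unfolded condI_def] op cover] by blast
  obtain J where J: "finite J" "F = ?U ` J"
    using finite_subset_image[OF F(1,2)] by blast
  show ?thesis
  proof (intro exI conjI ballI)
    show "0 \<le> (\<Sum>n\<in>J. real n)" by (simp add: sum_nonneg)
    fix f z assume f: "f \<in> unit_ball X N" and z: "z \<in> K"
    then obtain n where n: "n \<in> J" "f \<in> ?U n" using F(3) J(2) by blast
    then have "f z \<in> ball 0 (real n)" using z by blast
    then have "cmod (f z) \<le> real n" by simp
    also have "\<dots> \<le> (\<Sum>n\<in>J. real n)" using n(1) J(1) by (intro member_le_sum) auto
    finally show "cmod (f z) \<le> (\<Sum>n\<in>J. real n)" .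
  qed
qed

lemma condI_imp_eval_norm_finite:
  assumes X: "normed_space_on_disc X N" and I: "condI X N" and z: "z \<in> unit_disc"
  shows "eval_norm X N z < \<infinity>"
proof -
  have "{z} \<subseteq> unit_disc" using z by simp
  from condI_imp_locally_bounded[OF X I _ this]
  obtain C where C: "\<forall>f\<in>unit_ball X N. \<forall>x\<in>{z}. cmod (f x) \<le> C" by (meson finite.intros finite_imp_compact)
  have "eval_norm X N z \<le> ennreal C"
    unfolding op_norm_def using C by (intro SUP_least ennreal_leI) blast
  also have "\<dots> < \<infinity>" by simp
  finally show ?thesis .
qed

lemma deriv_bound_on_cball:
  assumes f: "f holomorphic_on S" and sub: "cball \<zeta> \<delta> \<subseteq> S" and d: "0 < \<delta>"
    and le: "\<And>x. x \<in> cball \<zeta> \<delta> \<Longrightarrow> cmod (f x) \<le> C"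
  shows "cmod (deriv f \<zeta>) \<le> C / \<delta>"
proof -
  have "cmod ((deriv ^^ 1) f \<zeta>) \<le> fact 1 * C / \<delta> ^ 1"
  proof (rule Cauchy_inequality)
    show "f holomorphic_on ball \<zeta> \<delta>" using f sub by (meson ball_subset_cball holomorphic_on_subset)
    show "continuous_on (cball \<zeta> \<delta>) f"
      using f sub by (meson holomorphic_on_imp_continuous_on continuous_on_subset)
    fix x assume "cmod (\<zeta> - x) = \<delta>"
    then show "cmod (f x) \<le> C" by (intro le) (simp add: dist_norm)
  qed (rule d)
  then show ?thesis by simp
qed

lemma holomorphic_increment_bound:
  assumes S: "convex S" "S \<subseteq> unit_disc" and f: "f holomorphic_on unit_disc"
    and le: "\<And>x. x \<in> S \<Longrightarrow> cmod (deriv f x) \<le> C" and xy: "x \<in> S" "y \<in> S"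
  shows "cmod (f x - f y) \<le> C * cmod (x - y)"
proof (rule field_differentiable_bound[OF S(1) _ le xy(1) xy(2)])
  fix z assume "z \<in> S"
  then show "(f has_field_derivative deriv f z) (at z within S)"
    using S(2) by (auto intro: has_field_derivative_at_within[OF holomorphic_derivI[OF f open_ball]])
qed

text \<open>Local boundedness bounds the derivatives of the functions in the unit ball uniformly on compact
  sets, so that they are equicontinuous there.\<close>

lemma dilation_uniformly_close:
  assumes X: "normed_space_on_disc X N" and I: "condI X N" and s: "0 \<le> s" "s < 1" and e: "0 < e"
  obtains r where "0 < r" "r < 1"
    and "\<And>f z. f \<in> unit_ball X N \<Longrightarrow> cmod z \<le> s \<Longrightarrow> cmod (f z - dilation r f z) \<le> e"
proof -
  define d where "d = (1 - s) / 2"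
  have d: "0 < d" "s + d < 1" using s by (auto simp: d_def field_simps)
  have "cball 0 (s + d) \<subseteq> unit_disc" using d by auto
  from condI_imp_locally_bounded[OF X I compact_cball this]
  obtain C where C: "0 \<le> C" "\<forall>f\<in>unit_ball X N. \<forall>z\<in>cball 0 (s + d). cmod (f z) \<le> C" by blast
  define r where "r = max (1/2) (1 - e * d / (C + 1))"
  have "0 < e * d / (C + 1)" using e d C(1) by simp
  then have r: "0 < r" "r < 1" "1 - r \<le> e * d / (C + 1)" by (auto simp: r_def)
  show ?thesis
  proof
    show "0 < r" "r < 1" by fact+
    fix f z assume f: "f \<in> unit_ball X N" and z: "cmod z \<le> s"
    have hol: "f holomorphic_on unit_disc"
      using f normed_space_on_discD(1)[OF X] Hol_discD(1) by auto
    have sub: "cball \<zeta> d \<subseteq> cball 0 (s + d)" if "\<zeta> \<in> cball 0 s" for \<zeta> :: complex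
    proof
      fix x assume "x \<in> cball \<zeta> d"
      then have "cmod x \<le> cmod \<zeta> + d"
        using norm_triangle_sub[of x \<zeta>] by (simp add: dist_norm norm_minus_commute)
      then show "x \<in> cball 0 (s + d)" using that by simp
    qed
    have der: "cmod (deriv f \<zeta>) \<le> C / d" if "\<zeta> \<in> cball 0 s" for \<zeta>
    proof (rule deriv_bound_on_cball[OF hol])
      show "cball \<zeta> d \<subseteq> unit_disc" using sub[OF that] d by (force simp: subset_iff)
      show "cmod (f x) \<le> C" if "x \<in> cball \<zeta> d" for x using C(2) f sub[OF \<open>\<zeta> \<in> cball 0 s\<close>] that by blast
    qed (rule d)
    have rz: "cmod (of_real r * z) \<le> cmod z"
      using r by (simp add: norm_mult mult_left_le_one_le)
    have "cmod (z - of_real r * z) = cmod (of_real (1 - r) * z)" by (simp add: algebra_simps)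
    also have "\<dots> = (1 - r) * cmod z" using r by (simp only: norm_mult norm_of_real abs_of_nonneg)
    also have "\<dots> \<le> e * d / (C + 1) * 1" using r z s by (intro mult_mono) auto
    finally have close: "cmod (z - of_real r * z) \<le> e * d / (C + 1)" by simp
    have "cmod (f z - f (of_real r * z)) \<le> C / d * cmod (z - of_real r * z)"
      using rz z s by (intro holomorphic_increment_bound[of "cball 0 s"] hol der) auto
    also have "\<dots> \<le> C / d * (e * d / (C + 1))"
      using C(1) d by (intro mult_left_mono close) simp
    also have "\<dots> \<le> e" using C(1) d e by (simp add: field_simps)
    finally show "cmod (f z - dilation r f z) \<le> e"
      using z s by (simp add: dilation_def on_disc_def)
  qed
qed


section \<open>The derivative of the generalized Volterra operator\<close>

lemma volterra_primitive:
  assumes g: "g holomorphic_on unit_disc" and \<phi>: "\<phi> ` unit_disc \<subseteq> unit_disc"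
    and f: "f holomorphic_on unit_disc"
  obtains F where "\<And>\<xi>. \<xi> \<in> unit_disc \<Longrightarrow> (F has_field_derivative f \<xi> * deriv g \<xi>) (at \<xi>)"
    and "\<And>z. z \<in> unit_disc \<Longrightarrow>
      ((\<lambda>\<xi>. f \<xi> * deriv g \<xi>) has_contour_integral volterra g \<phi> f z) (linepath 0 (\<phi> z))"
    and "\<And>z. z \<in> unit_disc \<Longrightarrow> volterra g \<phi> f z = F (\<phi> z) - F 0"
proof -
  have "(\<lambda>\<xi>. f \<xi> * deriv g \<xi>) holomorphic_on unit_disc"
    by (intro holomorphic_intros f g holomorphic_deriv) auto
  from holomorphic_convex_primitive'[OF convex_ball open_ball this]
  obtain F where F: "\<And>\<xi>. \<xi> \<in> unit_disc \<Longrightarrow>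
      (F has_field_derivative f \<xi> * deriv g \<xi>) (at \<xi> within unit_disc)"
    by blast
  have int: "((\<lambda>\<xi>. f \<xi> * deriv g \<xi>) has_contour_integral F (\<phi> z) - F 0) (linepath 0 (\<phi> z))"
    if "z \<in> unit_disc" for z
  proof -
    have "\<phi> z \<in> unit_disc" using \<phi> that by blast
    then have "closed_segment 0 (\<phi> z) \<subseteq> unit_disc"
      by (intro closed_segment_subset) auto
    then show ?thesis
      using contour_integral_primitive[OF F valid_path_linepath, of 0 "\<phi> z"] by simp
  qed
  have v: "volterra g \<phi> f z = F (\<phi> z) - F 0" if "z \<in> unit_disc" for z
    using contour_integral_unique[OF int[OF that]] that by (simp add: volterra_def on_disc_def)
  show ?thesis
    using that[of F] F int v by (simp add: at_within_open[OF _ open_ball])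
qed

lemma deriv_volterra:
  assumes g: "g holomorphic_on unit_disc"
    and \<phi>: "\<phi> holomorphic_on unit_disc" "\<phi> ` unit_disc \<subseteq> unit_disc"
    and f: "f holomorphic_on unit_disc" and z: "z \<in> unit_disc"
  shows "deriv (volterra g \<phi> f) z = f (\<phi> z) * deriv (g \<circ> \<phi>) z"
proof -
  obtain F where F: "\<And>\<xi>. \<xi> \<in> unit_disc \<Longrightarrow> (F has_field_derivative f \<xi> * deriv g \<xi>) (at \<xi>)"
    and v: "\<And>z. z \<in> unit_disc \<Longrightarrow> volterra g \<phi> f z = F (\<phi> z) - F 0"
    by (rule volterra_primitive[OF g \<phi>(2) f]) blast
  have \<phi>z: "\<phi> z \<in> unit_disc" using \<phi>(2) z by blast
  have d\<phi>: "(\<phi> has_field_derivative deriv \<phi> z) (at z)"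
    by (rule holomorphic_derivI[OF \<phi>(1) open_ball z])
  have "((\<lambda>z. F (\<phi> z) - F 0) has_field_derivative f (\<phi> z) * deriv g (\<phi> z) * deriv \<phi> z) (at z)"
    using DERIV_chain2[OF F[OF \<phi>z] d\<phi>] by (auto intro!: derivative_eq_intros)
  then have "(volterra g \<phi> f has_field_derivative f (\<phi> z) * deriv g (\<phi> z) * deriv \<phi> z) (at z)"
    by (rule has_field_derivative_transform_within_open[OF _ open_ball z]) (simp add: v)
  moreover have "deriv (g \<circ> \<phi>) z = deriv g (\<phi> z) * deriv \<phi> z"
    by (rule deriv_chain[OF holomorphic_on_imp_differentiable_at[OF \<phi>(1) open_ball z]
          holomorphic_on_imp_differentiable_at[OF g open_ball \<phi>z]])
  ultimately show ?thesis by (simp add: DERIV_imp_deriv)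
qed

lemma volterra_bound:
  assumes g: "g holomorphic_on unit_disc" and \<phi>: "\<phi> ` unit_disc \<subseteq> unit_disc" and z: "z \<in> unit_disc"
  obtains Q where "0 \<le> Q"
    and "\<And>f e. f holomorphic_on unit_disc \<Longrightarrow> 0 \<le> e \<Longrightarrow>
      (\<And>\<xi>. cmod \<xi> \<le> cmod (\<phi> z) \<Longrightarrow> cmod (f \<xi>) \<le> e) \<Longrightarrow> cmod (volterra g \<phi> f z) \<le> Q * e"
proof -
  have "\<phi> z \<in> unit_disc" using \<phi> z by blast
  then have \<phi>z: "cmod (\<phi> z) < 1" by simp
  have "deriv g holomorphic_on unit_disc" by (intro holomorphic_deriv g) auto
  then have "continuous_on (cball 0 (cmod (\<phi> z))) (deriv g)"
    using \<phi>z by (intro holomorphic_on_imp_continuous_on) (erule holomorphic_on_subset, auto)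
  then have "bounded (deriv g ` cball 0 (cmod (\<phi> z)))"
    using compact_continuous_image compact_imp_bounded compact_cball by blast
  then obtain b where b: "\<And>\<xi>. \<xi> \<in> cball 0 (cmod (\<phi> z)) \<Longrightarrow> cmod (deriv g \<xi>) \<le> b"
    unfolding bounded_iff by blast
  have "cmod (deriv g 0) \<le> b" by (rule b) simp
  then have b0: "0 \<le> b" by (rule order_trans[OF norm_ge_zero])
  show ?thesis
  proof
    show "0 \<le> b * cmod (\<phi> z)" using b0 by simp
    fix f and e :: real
    assume f: "f holomorphic_on unit_disc" and e: "0 \<le> e"
      and le: "\<And>\<xi>. cmod \<xi> \<le> cmod (\<phi> z) \<Longrightarrow> cmod (f \<xi>) \<le> e"
    have int: "((\<lambda>\<xi>. f \<xi> * deriv g \<xi>) has_contour_integral volterra g \<phi> f z) (linepath 0 (\<phi> z))"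
      by (rule volterra_primitive[OF g \<phi> f]) (use z in blast)
    have "cmod (volterra g \<phi> f z) \<le> (e * b) * cmod (\<phi> z - 0)"
    proof (rule has_contour_integral_bound_linepath[OF int])
      fix x assume "x \<in> closed_segment 0 (\<phi> z)"
      then have "x \<in> cball 0 (cmod (\<phi> z))"
        using closed_segment_subset[of 0 "cball 0 (cmod (\<phi> z))" "\<phi> z"] by auto
      then show "cmod (f x * deriv g x) \<le> e * b"
        using le b e by (auto simp: norm_mult intro!: mult_mono)
    qed (use e b0 in simp)
    then show "cmod (volterra g \<phi> f z) \<le> b * cmod (\<phi> z) * e" by (simp add: mult_ac)
  qed
qed

section \<open>The essential norm for targets normed by a weighted derivative\<close>

text \<open>Both targets of the theorem are instances of the following setting: their norm is equivalent to
  \<open>|h 0| + sup w |h'|\<close> for some nonnegative \<open>w\<close>, with constants \<open>A\<close> and \<open>B\<close> in the two directions. The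
  constant \<open>D\<close> bounds the dilations. The constants of the final estimate are built from \<open>A\<close>, \<open>B\<close> and
  \<open>D\<close> only, hence do not depend on \<open>g\<close> and \<open>\<phi>\<close>.\<close>

locale volterra_into_derivative_norm =
  fixes X Y :: "(complex \<Rightarrow> complex) set" and N M :: "(complex \<Rightarrow> complex) \<Rightarrow> real"
    and w :: "complex \<Rightarrow> real" and A B D :: real and g \<phi> :: "complex \<Rightarrow> complex"
  assumes X: "normed_space_on_disc X N" and Y: "normed_space_on_disc Y M"
    and one: "on_disc (\<lambda>z. 1) \<in> X"
    and I: "condI X N" and II: "condII X N" and III: "condIII X N"
    and dilation_bound: "\<And>r. 0 < r \<Longrightarrow> r < 1 \<Longrightarrow> op_norm X N N (dilation r) \<le> ennreal D"
    and w_nonneg: "\<And>z. z \<in> unit_disc \<Longrightarrow> 0 \<le> w z"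
    and deriv_le_norm: "\<And>h z. h \<in> Y \<Longrightarrow> z \<in> unit_disc \<Longrightarrow> w z * cmod (deriv h z) \<le> A * M h"
    and norm_le_deriv: "\<And>h S. h \<in> Y \<Longrightarrow> 0 \<le> S \<Longrightarrow>
      (\<And>z. z \<in> unit_disc \<Longrightarrow> w z * cmod (deriv h z) \<le> S) \<Longrightarrow> M h \<le> B * (cmod (h 0) + S)"
    and pos: "0 < A" "0 < B" "0 < D"
    and g: "g holomorphic_on unit_disc"
    and \<phi>: "\<phi> holomorphic_on unit_disc" "\<phi> ` unit_disc \<subseteq> unit_disc"
    and bounded_T: "bounded_operator X N Y M (volterra g \<phi>)"
begin

abbreviation "T \<equiv> volterra g \<phi>"

definition symbol :: "complex \<Rightarrow> real" where
  "symbol z = w z * cmod (deriv (g \<circ> \<phi>) z)"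

definition density :: "complex \<Rightarrow> ennreal" where
  "density z = ennreal (symbol z) * eval_norm X N (\<phi> z)"

lemma symbol_nonneg: "z \<in> unit_disc \<Longrightarrow> 0 \<le> symbol z"
  using w_nonneg by (simp add: symbol_def)

lemma linear_T: "linear_operator X Y T"
  using bounded_T by (simp add: bounded_operator_def)

lemma \<phi>_in_disc: "z \<in> unit_disc \<Longrightarrow> \<phi> z \<in> unit_disc"
  using \<phi>(2) by blast

lemma holomorphic: "f \<in> X \<Longrightarrow> f holomorphic_on unit_disc"
  using normed_space_on_discD(1)[OF X] Hol_discD(1) by blast

lemma dilation_in_X: "0 < r \<Longrightarrow> r < 1 \<Longrightarrow> f \<in> X \<Longrightarrow> dilation r f \<in> X"
  using III linear_operatorD(1) unfolding condIII_def compact_operator_def by blast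

lemma norm_dilation_le:
  assumes "0 < r" "r < 1" "f \<in> X"
  shows "N (dilation r f) \<le> D * N f"
proof (rule operator_norm_bound[OF X X])
  show "linear_operator X X (dilation r)"
    using III assms unfolding condIII_def compact_operator_def by blast
qed (use assms pos dilation_bound in auto)

lemma symbol_eval_le:
  assumes f: "f \<in> X" and z: "z \<in> unit_disc"
  shows "symbol z * cmod (f (\<phi> z)) \<le> A * M (T f)"
  using deriv_le_norm[OF linear_operatorD(1)[OF linear_T f] z]
  by (simp add: deriv_volterra[OF g \<phi> holomorphic[OF f] z] symbol_def norm_mult mult_ac)

lemma density_eq_SUP:
  "z \<in> unit_disc \<Longrightarrow> density z = (SUP f\<in>unit_ball X N. ennreal (symbol z * cmod (f (\<phi> z))))"
  unfolding density_def op_norm_def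
  by (simp add: SUP_mult_left_ennreal ennreal_mult symbol_nonneg)

lemma density_bounded:
  obtains R where "0 \<le> R" and "\<And>z. z \<in> unit_disc \<Longrightarrow> density z \<le> ennreal R"
proof -
  obtain t where t: "0 \<le> t" "op_norm X N M T \<le> ennreal t"
    using bounded_T unfolding bounded_operator_def by (cases "op_norm X N M T") auto
  show ?thesis
  proof (rule that[of "A * t"])
    show "0 \<le> A * t" using t pos by simp
    fix z assume z: "z \<in> unit_disc"
    have "symbol z * cmod (f (\<phi> z)) \<le> A * t" if f: "f \<in> unit_ball X N" for f
    proof -
      have "M (T f) \<le> t * N f" using f by (intro operator_norm_bound[OF X Y linear_T t(2,1)]) simp
      also have "\<dots> \<le> t * 1" using f t by (intro mult_left_mono) auto
      finally have "A * M (T f) \<le> A * t" using pos by simp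
      then show ?thesis using symbol_eval_le[of f z] f z by simp
    qed
    then show "density z \<le> ennreal (A * t)"
      unfolding density_eq_SUP[OF z] by (intro SUP_least ennreal_leI) blast
  qed
qed

lemma eval_norm_real:
  assumes "z \<in> unit_disc"
  obtains d where "0 \<le> d" and "eval_norm X N z = ennreal d"
  using condI_imp_eval_norm_finite[OF X I assms] by (cases "eval_norm X N z") auto

text \<open>The operator is approximated by its compact compositions with dilations. Where \<open>|\<phi>| \<le> s\<close> the
  dilation moves the functions of the unit ball by little, and the symbol is bounded because \<open>T 1\<close>
  belongs to the target; elsewhere the difference \<open>f - f\<^sub>r\<close>, of norm at most \<open>1 + D\<close>, is bounded by
  the evaluation functional.\<close>

lemma essential_norm_le_SUP:
  assumes s: "0 \<le> s" "s < 1"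
  shows "essential_norm X N Y M T
    \<le> ennreal (B * (1 + D)) * (SUP z\<in>{z \<in> unit_disc. s < cmod (\<phi> z)}. density z)" (is "_ \<le> _ * ?G")
proof (rule ennreal_le_epsilon)
  fix \<epsilon> :: real assume \<epsilon>: "0 < \<epsilon>"
  obtain R where R: "\<And>z. z \<in> unit_disc \<Longrightarrow> density z \<le> ennreal R"
    using density_bounded by blast
  have "?G \<le> ennreal R" by (rule SUP_least) (use R in auto)
  also have "\<dots> < top" by simp
  finally obtain \<gamma> where \<gamma>: "0 \<le> \<gamma>" "?G = ennreal \<gamma>" unfolding less_top_ennreal by blast
  define P where "P = A * M (T (on_disc (\<lambda>z. 1)))"
  have P: "symbol z \<le> P" if "z \<in> unit_disc" for z
    using symbol_eval_le[OF one that] \<phi>_in_disc[OF that] by (simp add: on_disc_def P_def)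
  have P0: "0 \<le> P"
    using normed_space_on_discD(4)[OF Y linear_operatorD(1)[OF linear_T one]] pos by (simp add: P_def)
  have zero: "0 \<in> unit_disc" by simp
  obtain Q where Q: "0 \<le> Q" "\<And>f e. f holomorphic_on unit_disc \<Longrightarrow> 0 \<le> e \<Longrightarrow>
      (\<And>\<xi>. cmod \<xi> \<le> cmod (\<phi> 0) \<Longrightarrow> cmod (f \<xi>) \<le> e) \<Longrightarrow> cmod (T f 0) \<le> Q * e"
    by (rule volterra_bound[OF g \<phi>(2) zero]) blast
  \<comment> \<open>the error terms at the point \<open>0\<close> and on \<open>|\<phi>| \<le> s\<close> add up to \<open>B * (Q + P) * e\<close>\<close>
  define e where "e = \<epsilon> / (B * (Q + P) + 1)"
  have e: "0 < e" "B * (Q + P) * e \<le> \<epsilon>"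
  proof -
    have "0 \<le> B * (Q + P)" using Q(1) P0 pos by simp
    then show "0 < e" "B * (Q + P) * e \<le> \<epsilon>"
      using \<epsilon> by (simp_all add: e_def pos_divide_le_eq distrib_left mult.commute del: mult_nonneg_nonneg)
  qed
  \<comment> \<open>\<open>T f 0\<close> is an integral over the segment from \<open>0\<close> to \<open>\<phi> 0\<close>, which must be covered as well\<close>
  define t where "t = max s (cmod (\<phi> 0))"
  have t: "0 \<le> t" "t < 1" using s \<phi>_in_disc[OF zero] by (auto simp: t_def)
  obtain r where r: "0 < r" "r < 1"
    and close: "\<And>f z. f \<in> unit_ball X N \<Longrightarrow> cmod z \<le> t \<Longrightarrow> cmod (f z - dilation r f z) \<le> e"
    using dilation_uniformly_close[OF X I t e(1)] by blast
  let ?K = "\<lambda>f. T (dilation r f)"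
  have K: "compact_operator X N Y M ?K"
    using III r by (intro compact_operator_compose[OF X Y bounded_T]) (auto simp: condIII_def)
  have "M (\<lambda>z. T f z - ?K f z) \<le> \<epsilon> + B * (1 + D) * \<gamma>" if f: "f \<in> unit_ball X N" for f
  proof -
    let ?u = "\<lambda>z. f z - dilation r f z"
    have fX: "f \<in> X" and Nf: "N f \<le> 1" using f by auto
    note dX = dilation_in_X[OF r fX]
    have uX: "?u \<in> X" by (rule normed_space_diff(1)[OF X fX dX])
    have "D * N f \<le> D * 1" using pos Nf by (intro mult_left_mono) auto
    then have Nu: "N ?u \<le> 1 + D"
      using normed_space_diff(2)[OF X fX dX] norm_dilation_le[OF r fX] Nf by linarith
    have Tu: "(\<lambda>z. T f z - ?K f z) = T ?u"
      using linear_operator_diff[OF X linear_T fX dX] by simp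
    have "cmod (T ?u 0) \<le> Q * e"
      using close[OF f] e by (intro Q(2) holomorphic[OF uX]) (auto simp: t_def)
    moreover have "w z * cmod (deriv (T ?u) z) \<le> P * e + (1 + D) * \<gamma>" if z: "z \<in> unit_disc" for z
    proof -
      have eq: "w z * cmod (deriv (T ?u) z) = symbol z * cmod (?u (\<phi> z))"
        by (simp add: deriv_volterra[OF g \<phi> holomorphic[OF uX] z] symbol_def norm_mult mult_ac)
      show ?thesis
      proof (cases "cmod (\<phi> z) \<le> s")
        case True
        then have "symbol z * cmod (?u (\<phi> z)) \<le> P * e"
          using close[OF f, of "\<phi> z"] P[OF z] P0 by (intro mult_mono) (auto simp: t_def)
        then show ?thesis unfolding eq using pos \<gamma>(1) by (smt (verit) mult_nonneg_nonneg)
      next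
        case False
        obtain d where d: "0 \<le> d" "eval_norm X N (\<phi> z) = ennreal d"
          using eval_norm_real[OF \<phi>_in_disc[OF z]] by blast
        have "density z \<le> ?G" using False z by (intro SUP_upper) auto
        then have sd: "symbol z * d \<le> \<gamma>"
          using d \<gamma> symbol_nonneg[OF z] by (simp add: density_def ennreal_mult[symmetric] ennreal_le_iff)
        have "cmod (?u (\<phi> z)) \<le> d * N ?u"
          by (rule eval_norm_bound[OF X _ d(1) uX]) (simp add: d)
        also have "\<dots> \<le> d * (1 + D)" by (rule mult_left_mono[OF Nu d(1)])
        finally have "symbol z * cmod (?u (\<phi> z)) \<le> symbol z * (d * (1 + D))"
          by (rule mult_left_mono[OF _ symbol_nonneg[OF z]])
        also have "\<dots> = symbol z * d * (1 + D)" by simp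
        also have "\<dots> \<le> \<gamma> * (1 + D)" using sd pos by (intro mult_right_mono) auto
        finally show ?thesis
          unfolding eq using mult_nonneg_nonneg[OF P0 less_imp_le[OF e(1)]] by (simp add: mult.commute)
      qed
    qed
    ultimately have "M (T ?u) \<le> B * (cmod (T ?u 0) + (P * e + (1 + D) * \<gamma>))"
      using P0 e(1) pos \<gamma>(1) by (intro norm_le_deriv linear_operatorD(1)[OF linear_T uX]) auto
    also have "\<dots> \<le> B * (Q * e + (P * e + (1 + D) * \<gamma>))"
      using \<open>cmod (T ?u 0) \<le> Q * e\<close> pos by (intro mult_left_mono) auto
    also have "\<dots> = B * (Q + P) * e + B * (1 + D) * \<gamma>" by (simp add: algebra_simps)
    also have "\<dots> \<le> \<epsilon> + B * (1 + D) * \<gamma>" using e(2) by simp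
    finally show ?thesis unfolding Tu .
  qed
  then have "op_norm X N M (\<lambda>f z. T f z - ?K f z) \<le> ennreal (\<epsilon> + B * (1 + D) * \<gamma>)"
    unfolding op_norm_def by (intro SUP_least ennreal_leI) blast
  also have "\<dots> = ennreal (B * (1 + D)) * ?G + ennreal \<epsilon>"
    using \<epsilon> pos \<gamma> by (simp add: ennreal_mult[symmetric] ennreal_plus[symmetric] add.commute del: ennreal_plus)
  finally show "essential_norm X N Y M T \<le> ennreal (B * (1 + D)) * ?G + ennreal \<epsilon>"
    unfolding essential_norm_def using K by (intro INF_lower2[of ?K]) auto
qed

lemma essential_norm_upper:
  "essential_norm X N Y M T \<le> ennreal (B * (1 + D)) * limsup_circle \<phi> density"
proof (rule tendsto_lowerbound)
  show "((\<lambda>s. ennreal (B * (1 + D)) * (SUP z\<in>{z \<in> unit_disc. s < cmod (\<phi> z)}. density z))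
      \<longlongrightarrow> ennreal (B * (1 + D)) * limsup_circle \<phi> density) (at_left 1)"
    by (intro ennreal_tendsto_cmult limsup_circle_tendsto) simp
  have "\<forall>\<^sub>F s in at_left (1::real). s \<in> {0<..<1}" by (rule eventually_at_left_real) simp
  then show "\<forall>\<^sub>F s in at_left 1. essential_norm X N Y M T
      \<le> ennreal (B * (1 + D)) * (SUP z\<in>{z \<in> unit_disc. s < cmod (\<phi> z)}. density z)"
    by eventually_elim (intro essential_norm_le_SUP, auto)
qed simp

text \<open>Dilating a nearly extremal function for the evaluation functional keeps it nearly extremal, and
  makes it bounded.\<close>

lemma bounded_test_function:
  assumes z: "z \<in> unit_disc" and l: "ennreal l < density z" "0 \<le> l"
  obtains f b where "f \<in> X" "N f \<le> D" "l < symbol z * cmod (f (\<phi> z))"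
    and "\<And>\<xi>. \<xi> \<in> unit_disc \<Longrightarrow> cmod (f \<xi>) \<le> b"
proof -
  obtain k where k: "k \<in> unit_ball X N" and lk: "l < symbol z * cmod (k (\<phi> z))"
    using l unfolding density_eq_SUP[OF z] less_SUP_iff by (auto simp: ennreal_less_iff)
  have kX: "k \<in> X" and Nk: "N k \<le> 1" using k by auto
  have "isCont k (\<phi> z)"
    using holomorphic_on_imp_continuous_on[OF holomorphic[OF kX]] \<phi>_in_disc[OF z]
    by (simp add: continuous_on_eq_continuous_at)
  moreover have "((\<lambda>r::real. of_real r * \<phi> z) \<longlongrightarrow> \<phi> z) (at_left 1)"
    by (auto intro!: tendsto_eq_intros)
  ultimately have "((\<lambda>r::real. k (of_real r * \<phi> z)) \<longlongrightarrow> k (\<phi> z)) (at_left 1)"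
    by (rule isCont_tendsto_compose)
  then have "((\<lambda>r::real. symbol z * cmod (k (of_real r * \<phi> z))) \<longlongrightarrow> symbol z * cmod (k (\<phi> z))) (at_left 1)"
    by (intro tendsto_intros)
  from order_tendstoD(1)[OF this lk]
  have "\<forall>\<^sub>F r in at_left (1::real). l < symbol z * cmod (k (of_real r * \<phi> z))" .
  moreover have "\<forall>\<^sub>F r in at_left (1::real). r \<in> {0<..<1}" by (rule eventually_at_left_real) simp
  ultimately have "\<forall>\<^sub>F r in at_left (1::real). r \<in> {0<..<1} \<and> l < symbol z * cmod (k (of_real r * \<phi> z))"
    by eventually_elim simp
  then obtain r :: real where r: "0 < r" "r < 1" and lr: "l < symbol z * cmod (k (of_real r * \<phi> z))"
    using eventually_happens'[OF trivial_limit_at_left_real] by force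
  have "continuous_on (cball 0 r) k"
    using r by (intro holomorphic_on_imp_continuous_on holomorphic_on_subset[OF holomorphic[OF kX]]) auto
  then have "bounded (k ` cball 0 r)"
    using compact_continuous_image compact_imp_bounded compact_cball by blast
  then obtain b where b: "\<forall>x\<in>cball 0 r. cmod (k x) \<le> b"
    unfolding bounded_iff by blast
  show ?thesis
  proof (rule that[of "dilation r k" b])
    show "dilation r k \<in> X" by (rule dilation_in_X[OF r kX])
    have "D * N k \<le> D * 1" using pos Nk by (intro mult_left_mono) auto
    then show "N (dilation r k) \<le> D" using norm_dilation_le[OF r kX] by linarith
    show "l < symbol z * cmod (dilation r k (\<phi> z))"
      using lr \<phi>_in_disc[OF z] by (simp add: dilation_def on_disc_def)
    fix \<xi> :: complex assume \<xi>: "\<xi> \<in> unit_disc"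
    then have "r * cmod \<xi> \<le> r * 1" using r by (intro mult_left_mono) auto
    then have "of_real r * \<xi> \<in> cball 0 r" using r by (simp add: norm_mult)
    then show "cmod (dilation r k \<xi>) \<le> b" using b \<xi> by (simp add: dilation_def on_disc_def)
  qed
qed

text \<open>As the density is bounded, the symbol tends to zero wherever the evaluation functionals blow
  up.\<close>

lemma symbol_tendsto_0:
  assumes z: "\<And>n. z n \<in> unit_disc" and lim: "(\<lambda>n. cmod (\<phi> (z n))) \<longlonglongrightarrow> 1"
  shows "(\<lambda>n. symbol (z n)) \<longlonglongrightarrow> 0"
proof (rule order_tendstoI)
  show "\<forall>\<^sub>F n in sequentially. y < symbol (z n)" if "y < 0" for y
    using that symbol_nonneg[OF z] by (intro always_eventually allI) (auto intro: less_le_trans)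
next
  fix \<eta> :: real assume \<eta>: "0 < \<eta>"
  obtain R where R: "0 \<le> R" "\<And>z. z \<in> unit_disc \<Longrightarrow> density z \<le> ennreal R"
    using density_bounded by blast
  have "filterlim (\<lambda>n. cmod (\<phi> (z n))) (at_left 1) sequentially"
    unfolding filterlim_at using lim \<phi>_in_disc[OF z] by (auto simp: less_imp_neq)
  then have "filterlim (\<lambda>n. \<phi> (z n)) to_circle sequentially"
    by (simp add: filterlim_filtercomap_iff comp_def)
  then have "((\<lambda>n. eval_norm X N (\<phi> (z n))) \<longlongrightarrow> \<infinity>) sequentially"
    using II unfolding condII_def by (rule filterlim_compose[rotated])
  then have "\<forall>\<^sub>F n in sequentially. ennreal ((R + 1) / \<eta>) < eval_norm X N (\<phi> (z n))"
    by (rule order_tendstoD) simp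
  then show "\<forall>\<^sub>F n in sequentially. symbol (z n) < \<eta>"
  proof eventually_elim
    case (elim n)
    obtain d where d: "0 \<le> d" "eval_norm X N (\<phi> (z n)) = ennreal d"
      using eval_norm_real[OF \<phi>_in_disc[OF z]] by blast
    have large: "(R + 1) / \<eta> \<le> d" using elim d R(1) \<eta> by (simp add: ennreal_less_iff)
    have "symbol (z n) * d \<le> R"
      using R(2)[OF z, of n] R(1) d symbol_nonneg[OF z, of n]
      by (simp add: density_def ennreal_mult[symmetric] ennreal_le_iff)
    moreover have "symbol (z n) * ((R + 1) / \<eta>) \<le> symbol (z n) * d"
      by (rule mult_left_mono[OF large symbol_nonneg[OF z]])
    ultimately have "symbol (z n) * (R + 1) / \<eta> \<le> R" by simp
    then have "symbol (z n) * (R + 1) \<le> R * \<eta>" using \<eta> by (simp only: pos_divide_le_eq)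
    also have "\<dots> < \<eta> * (R + 1)" using \<eta> by (simp add: algebra_simps)
    finally show ?case using R(1) by simp
  qed
qed

text \<open>Let \<open>z\<^sub>n\<close> be points with \<open>|\<phi>(z\<^sub>n)| \<rightarrow> 1\<close> at which the density exceeds \<open>l\<close>, with bounded test
  functions \<open>e\<^sub>n\<close>. A compact \<open>K\<close> maps infinitely many \<open>e\<^sub>n\<close> close to the image of one \<open>e\<^sub>m\<close>, so \<open>T - K\<close> acts on
  \<open>e\<^sub>n - e\<^sub>m\<close> almost as \<open>T\<close> does. Since \<open>e\<^sub>m\<close> is bounded and the symbol tends to zero along \<open>z\<^sub>n\<close>, subtracting
  \<open>e\<^sub>m\<close> makes no difference at \<open>z\<^sub>n\<close> in the limit, and \<open>e\<^sub>n\<close> contributes more than \<open>l\<close> there.\<close>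

lemma limsup_le_op_norm_minus_compact:
  assumes K: "compact_operator X N Y M K"
    and R: "0 \<le> R" "op_norm X N M (\<lambda>f z. T f z - K f z) \<le> ennreal R"
  shows "limsup_circle \<phi> density \<le> ennreal (2 * A * D * R)"
proof (rule ccontr)
  assume "\<not> ?thesis"
  then have "ennreal (2 * A * D * R) < limsup_circle \<phi> density" by simp
  then obtain y where y: "ennreal (2 * A * D * R) < y" "y < limsup_circle \<phi> density"
    using dense by blast
  obtain l where l: "0 \<le> l" "y = ennreal l" using y(2) by (cases y) auto
  have big: "2 * A * D * R < l" using y(1) l R(1) pos by (simp add: ennreal_less_iff)
  have "\<exists>z. z \<in> unit_disc \<and> 1 - inverse (real (Suc n)) < cmod (\<phi> z) \<and> ennreal l < density z" for n
  proof -
    have "limsup_circle \<phi> density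
        \<le> (SUP z\<in>{z \<in> unit_disc. 1 - inverse (real (Suc n)) < cmod (\<phi> z)}. density z)"
      unfolding limsup_circle_eq_INF by (rule INF_lower) simp
    then have "ennreal l < (SUP z\<in>{z \<in> unit_disc. 1 - inverse (real (Suc n)) < cmod (\<phi> z)}. density z)"
      using y(2) l(2) by (simp add: less_le_trans)
    then show ?thesis unfolding less_SUP_iff by blast
  qed
  then obtain z where z: "\<And>n. z n \<in> unit_disc" "\<And>n. 1 - inverse (real (Suc n)) < cmod (\<phi> (z n))"
    "\<And>n. ennreal l < density (z n)" by metis
  have "(\<lambda>n. cmod (\<phi> (z n))) \<longlonglongrightarrow> 1"
  proof (rule tendsto_sandwich[OF _ _ LIMSEQ_inverse_real_of_nat_add_minus[of 1] tendsto_const])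
    show "\<forall>\<^sub>F n in sequentially. 1 + - inverse (real (Suc n)) \<le> cmod (\<phi> (z n))"
      using z(2) by (intro always_eventually allI) (auto simp: less_imp_le)
    show "\<forall>\<^sub>F n in sequentially. cmod (\<phi> (z n)) \<le> 1"
      using \<phi>_in_disc[OF z(1)] by (intro always_eventually allI) (auto simp: less_imp_le)
  qed
  then have sym0: "(\<lambda>n. symbol (z n)) \<longlonglongrightarrow> 0" by (rule symbol_tendsto_0[OF z(1)])
  have "\<exists>f b. f \<in> X \<and> N f \<le> D \<and> l < symbol (z n) * cmod (f (\<phi> (z n)))
      \<and> (\<forall>\<xi>\<in>unit_disc. cmod (f \<xi>) \<le> b)" for n
    by (rule bounded_test_function[OF z(1)[of n] z(3)[of n] l(1)]) blast
  then obtain e b where e: "\<And>n. e n \<in> X" "\<And>n. N (e n) \<le> D"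
      "\<And>n. l < symbol (z n) * cmod (e n (\<phi> (z n)))"
    and b: "\<And>n. \<forall>\<xi>\<in>unit_disc. cmod (e n \<xi>) \<le> b n" by metis
  define f where "f = (\<lambda>n z. of_real (1 / D) * e n z)"
  have fX: "f n \<in> X" for n unfolding f_def by (rule normed_space_on_discD(2)[OF X e(1)])
  have Nf: "N (f n) \<le> 1" for n
  proof -
    have "N (f n) = cmod (of_real (1 / D)) * N (e n)"
      unfolding f_def by (rule normed_space_on_discD(6)[OF X e(1)])
    also have "\<dots> = N (e n) / D" using pos by (simp add: norm_divide)
    finally show ?thesis using e(2)[of n] pos by simp
  qed
  \<comment> \<open>the estimates below yield \<open>l - \<epsilon> < 2 * A * D * R + A * D * \<epsilon>\<close>, which this \<open>\<epsilon>\<close> just violates\<close>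
  define \<epsilon> where "\<epsilon> = (l - 2 * A * D * R) / (1 + A * D)"
  have AD: "0 < 1 + A * D" using pos by (simp add: add_pos_pos)
  have \<epsilon>: "0 < \<epsilon>" using big AD by (simp add: \<epsilon>_def)
  have fball: "f n \<in> unit_ball X N" for n using fX Nf by simp
  obtain m where m: "\<exists>\<^sub>F n in sequentially. M (\<lambda>z. K (f n) z - K (f m) z) < \<epsilon>"
    by (rule compact_operator_frequently_close[OF Y K fball \<epsilon>])
  have "(\<lambda>n. symbol (z n) * b m) \<longlonglongrightarrow> 0 * b m" by (intro tendsto_intros sym0)
  then have "\<forall>\<^sub>F n in sequentially. symbol (z n) * b m < \<epsilon>"
    using \<epsilon> by (intro order_tendstoD(2)[where y = "0 * b m"]) auto
  from frequently_ex[OF frequently_eventually_conj[OF m this]]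
  obtain n where n: "symbol (z n) * b m < \<epsilon>" "M (\<lambda>z. K (f n) z - K (f m) z) < \<epsilon>" by blast
  let ?u = "\<lambda>z. f n z - f m z"
  let ?p = "symbol (z n)" and ?\<zeta> = "\<phi> (z n)"
  have linK: "linear_operator X Y K" using K by (simp add: compact_operator_def)
  have uX: "?u \<in> X" by (rule normed_space_diff(1)[OF X fX fX])
  have Nu: "N ?u \<le> 2" using normed_space_diff(2)[OF X fX[of n] fX[of m]] Nf[of n] Nf[of m] by linarith
  have Ku: "K ?u = (\<lambda>z. K (f n) z - K (f m) z)" by (rule linear_operator_diff[OF X linK fX fX])
  have Y1: "(\<lambda>z. T ?u z - K ?u z) \<in> Y" and Y2: "K ?u \<in> Y"
    using linear_operatorD(1)[OF linear_operator_minus[OF Y linear_T linK] uX]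
      linear_operatorD(1)[OF linK uX] by auto
  have "M (\<lambda>z. T ?u z - K ?u z) \<le> R * N ?u"
    by (rule operator_norm_bound[OF X Y linear_operator_minus[OF Y linear_T linK] R(2,1) uX])
  also have "\<dots> \<le> R * 2" by (rule mult_left_mono[OF Nu R(1)])
  finally have "M (T ?u) \<le> 2 * R + \<epsilon>"
    using normed_space_on_discD(7)[OF Y Y1 Y2] n(2) by (simp add: Ku)
  then have "A * M (T ?u) \<le> A * (2 * R + \<epsilon>)" using pos by (intro mult_left_mono) auto
  then have up: "?p * cmod (?u ?\<zeta>) \<le> A * (2 * R + \<epsilon>)"
    using symbol_eval_le[OF uX z(1), of n] by linarith
  have "cmod (e n ?\<zeta>) - b m \<le> cmod (e n ?\<zeta> - e m ?\<zeta>)"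
    using norm_triangle_ineq2[of "e n ?\<zeta>" "e m ?\<zeta>"] b[of m] \<phi>_in_disc[OF z(1)[of n]] by force
  also have "e n ?\<zeta> - e m ?\<zeta> = of_real D * ?u ?\<zeta>" using pos by (simp add: f_def field_simps)
  also have "cmod \<dots> = D * cmod (?u ?\<zeta>)" using pos by (simp add: norm_mult)
  finally have "?p * (cmod (e n ?\<zeta>) - b m) \<le> ?p * (D * cmod (?u ?\<zeta>))"
    by (rule mult_left_mono[OF _ symbol_nonneg[OF z(1)]])
  also have "\<dots> = D * (?p * cmod (?u ?\<zeta>))" by simp
  also have "\<dots> \<le> D * (A * (2 * R + \<epsilon>))" using up pos by (intro mult_left_mono) auto
  finally have "l - \<epsilon> < D * (A * (2 * R + \<epsilon>))"
    using e(3)[of n] n(1) by (simp add: right_diff_distrib)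
  then have "l - 2 * A * D * R < (1 + A * D) * \<epsilon>" by (simp add: algebra_simps)
  also have "\<dots> = l - 2 * A * D * R" using AD by (simp add: \<epsilon>_def)
  finally show False by simp
qed

lemma essential_norm_lower:
  "ennreal (1 / (2 * A * D)) * limsup_circle \<phi> density \<le> essential_norm X N Y M T"
  unfolding essential_norm_def
proof (rule INF_greatest)
  fix K assume "K \<in> {K. compact_operator X N Y M K}"
  then have K: "compact_operator X N Y M K" by simp
  show "ennreal (1 / (2 * A * D)) * limsup_circle \<phi> density \<le> op_norm X N M (\<lambda>f z. T f z - K f z)"
  proof (cases "op_norm X N M (\<lambda>f z. T f z - K f z)")
    case (real R)
    have "limsup_circle \<phi> density \<le> ennreal (2 * A * D * R)"
      using real by (intro limsup_le_op_norm_minus_compact[OF K]) auto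
    then have "ennreal (1 / (2 * A * D)) * limsup_circle \<phi> density
        \<le> ennreal (1 / (2 * A * D)) * ennreal (2 * A * D * R)"
      by (rule mult_left_mono) simp
    also have "\<dots> = ennreal R" using real pos by (simp add: ennreal_mult[symmetric])
    finally show ?thesis using real by simp
  qed simp
qed

lemma essential_norm_comparable:
  "comparable (B * (1 + D) + 2 * A * D) (essential_norm X N Y M T) (limsup_circle \<phi> density)"
  unfolding comparable_def
proof
  have "1 / (B * (1 + D) + 2 * A * D) \<le> 1 / (2 * A * D)"
    using pos by (intro divide_left_mono mult_pos_pos add_pos_pos) auto
  then have "ennreal (1 / (B * (1 + D) + 2 * A * D)) * limsup_circle \<phi> density
      \<le> ennreal (1 / (2 * A * D)) * limsup_circle \<phi> density"
    by (intro mult_right_mono ennreal_leI) auto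
  also note essential_norm_lower
  finally show "ennreal (1 / (B * (1 + D) + 2 * A * D)) * limsup_circle \<phi> density
      \<le> essential_norm X N Y M T" .
  note essential_norm_upper
  also have "ennreal (B * (1 + D)) * limsup_circle \<phi> density
      \<le> ennreal (B * (1 + D) + 2 * A * D) * limsup_circle \<phi> density"
    using pos by (intro mult_right_mono ennreal_leI) auto
  finally show "essential_norm X N Y M T
      \<le> ennreal (B * (1 + D) + 2 * A * D) * limsup_circle \<phi> density" .
qed

end

section \<open>Weighted supremum norms\<close>

text \<open>The functional \<^const>\<open>norm_Hv\<close> is applied to arbitrary functions on the disc, so that the same facts
  serve both target spaces: \<^const>\<open>norm_Bv\<close> applies it to the derivative.\<close>

abbreviation weighted_bounded :: "(complex \<Rightarrow> real) \<Rightarrow> (complex \<Rightarrow> complex) \<Rightarrow> bool" where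
  "weighted_bounded v u \<equiv> bdd_above ((\<lambda>z. v z * cmod (u z)) ` unit_disc)"

lemma weighted_boundedI:
  "(\<And>z. z \<in> unit_disc \<Longrightarrow> v z * cmod (u z) \<le> S) \<Longrightarrow> weighted_bounded v u"
  by (rule bdd_aboveI2)

lemma norm_Hv_upper:
  "weighted_bounded v u \<Longrightarrow> z \<in> unit_disc \<Longrightarrow> v z * cmod (u z) \<le> norm_Hv v u"
  unfolding norm_Hv_def by (rule cSUP_upper)

lemma norm_Hv_least:
  "(\<And>z. z \<in> unit_disc \<Longrightarrow> v z * cmod (u z) \<le> S) \<Longrightarrow> norm_Hv v u \<le> S"
  unfolding norm_Hv_def by (rule cSUP_least) auto

lemma norm_Hv_cong:
  "(\<And>z. z \<in> unit_disc \<Longrightarrow> u z = u' z) \<Longrightarrow> norm_Hv v u = norm_Hv v u'"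
  unfolding norm_Hv_def by (rule SUP_cong) auto

lemma weighted_bounded_cong:
  "(\<And>z. z \<in> unit_disc \<Longrightarrow> u z = u' z) \<Longrightarrow> weighted_bounded v u = weighted_bounded v u'"
  by (intro arg_cong[where f = bdd_above] image_cong) auto

lemma norm_Bv_eq: "norm_Bv v f = cmod (f 0) + norm_Hv v (deriv f)"
  by (simp add: norm_Bv_def norm_Hv_def)

context
  fixes v :: "complex \<Rightarrow> real"
  assumes v: "\<And>z. z \<in> unit_disc \<Longrightarrow> 0 < v z"
begin

lemma norm_Hv_nonneg: "weighted_bounded v u \<Longrightarrow> 0 \<le> norm_Hv v u"
  using norm_Hv_upper[of v u 0] v[of 0] by (auto intro: order_trans[rotated])

lemma norm_Hv_zero: "norm_Hv v (\<lambda>z. 0) = 0"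
  by (simp add: norm_Hv_def)

lemma norm_Hv_eq_0_imp: "weighted_bounded v u \<Longrightarrow> norm_Hv v u = 0 \<Longrightarrow> z \<in> unit_disc \<Longrightarrow> u z = 0"
  using norm_Hv_upper[of v u z] v[of z] by (simp add: mult_le_0_iff)

lemma norm_Hv_add:
  assumes "weighted_bounded v u" "weighted_bounded v u'"
  shows "weighted_bounded v (\<lambda>z. u z + u' z)" "norm_Hv v (\<lambda>z. u z + u' z) \<le> norm_Hv v u + norm_Hv v u'"
proof -
  have le: "v z * cmod (u z + u' z) \<le> norm_Hv v u + norm_Hv v u'" if z: "z \<in> unit_disc" for z
  proof -
    have "v z * cmod (u z + u' z) \<le> v z * (cmod (u z) + cmod (u' z))"
      using v[OF z] by (intro mult_left_mono norm_triangle_ineq) simp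
    also have "\<dots> \<le> norm_Hv v u + norm_Hv v u'"
      unfolding distrib_left using assms z by (intro add_mono norm_Hv_upper)
    finally show ?thesis .
  qed
  show "weighted_bounded v (\<lambda>z. u z + u' z)" by (rule weighted_boundedI) (rule le)
  show "norm_Hv v (\<lambda>z. u z + u' z) \<le> norm_Hv v u + norm_Hv v u'" by (rule norm_Hv_least) (rule le)
qed

lemma norm_Hv_scale:
  assumes "weighted_bounded v u"
  shows "weighted_bounded v (\<lambda>z. a * u z)" "norm_Hv v (\<lambda>z. a * u z) = cmod a * norm_Hv v u"
proof -
  have le: "v z * cmod (b * f z) \<le> cmod b * norm_Hv v f"
    if "weighted_bounded v f" "z \<in> unit_disc" for b f z
    using mult_left_mono[OF norm_Hv_upper[OF that] norm_ge_zero[of b]] by (simp add: norm_mult mult_ac)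
  have bdd: "weighted_bounded v (\<lambda>z. b * f z)" if "weighted_bounded v f" for b f
    by (rule weighted_boundedI) (rule le[OF that])
  have norm: "norm_Hv v (\<lambda>z. b * f z) \<le> cmod b * norm_Hv v f" if "weighted_bounded v f" for b f
    by (rule norm_Hv_least) (rule le[OF that])
  show "weighted_bounded v (\<lambda>z. a * u z)" by (rule bdd[OF assms])
  show "norm_Hv v (\<lambda>z. a * u z) = cmod a * norm_Hv v u"
  proof (cases "a = 0")
    case True
    then show ?thesis using norm_Hv_zero by simp
  next
    case False
    have "norm_Hv v u \<le> cmod (1 / a) * norm_Hv v (\<lambda>z. a * u z)"
      using norm[OF bdd[OF assms], of "1 / a" a] False by simp
    then have "cmod a * norm_Hv v u \<le> norm_Hv v (\<lambda>z. a * u z)"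
      using False by (simp add: norm_divide field_simps)
    then show ?thesis using norm[OF assms, of a] by simp
  qed
qed

lemma normed_space_Hv: "normed_space_on_disc (Hv v) (norm_Hv v)"
  unfolding normed_space_on_disc_def
proof (intro conjI ballI allI)
  show "Hv v \<subseteq> Hol_disc" by (auto simp: Hv_def)
  show "(\<lambda>z. 0) \<in> Hv v" by (auto simp: Hv_def Hol_disc_def intro: bdd_aboveI2[where M = 0])
next
  fix f h assume f: "f \<in> Hv v" and h: "h \<in> Hv v"
  show "(\<lambda>z. f z + h z) \<in> Hv v"
    using f h norm_Hv_add(1) by (auto simp: Hv_def Hol_disc_def intro!: holomorphic_on_add holomorphic_on_mult holomorphic_on_const)
  show "norm_Hv v (\<lambda>z. f z + h z) \<le> norm_Hv v f + norm_Hv v h"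
    using f h by (intro norm_Hv_add(2)) (auto simp: Hv_def)
next
  fix f a assume f: "f \<in> Hv v"
  then have bdd: "weighted_bounded v f" and hol: "f \<in> Hol_disc" by (auto simp: Hv_def)
  show "(\<lambda>z. a * f z) \<in> Hv v"
    using hol norm_Hv_scale(1)[OF bdd] by (auto simp: Hv_def Hol_disc_def intro!: holomorphic_on_add holomorphic_on_mult holomorphic_on_const)
  show "norm_Hv v (\<lambda>z. a * f z) = cmod a * norm_Hv v f" by (rule norm_Hv_scale(2)[OF bdd])
  show "0 \<le> norm_Hv v f" by (rule norm_Hv_nonneg[OF bdd])
  show "norm_Hv v f = 0 \<longleftrightarrow> f = (\<lambda>z. 0)"
    using norm_Hv_eq_0_imp[OF bdd] Hol_discD(2)[OF hol] norm_Hv_zero by fastforce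
qed

lemma normed_space_Bv: "normed_space_on_disc (Bv v) (norm_Bv v)"
  unfolding normed_space_on_disc_def
proof (intro conjI ballI allI)
  show "Bv v \<subseteq> Hol_disc" by (auto simp: Bv_def)
  show "(\<lambda>z. 0) \<in> Bv v" by (auto simp: Bv_def Hol_disc_def intro: bdd_aboveI2[where M = 0])
next
  fix f h assume f: "f \<in> Bv v" and h: "h \<in> Bv v"
  then have bdd: "weighted_bounded v (deriv f)" "weighted_bounded v (deriv h)"
    and hol: "f \<in> Hol_disc" "h \<in> Hol_disc" by (auto simp: Bv_def)
  have der: "deriv (\<lambda>z. f z + h z) z = deriv f z + deriv h z" if "z \<in> unit_disc" for z
    using holomorphic_on_imp_differentiable_at[OF Hol_discD(1)[OF hol(1)] open_ball that]
      holomorphic_on_imp_differentiable_at[OF Hol_discD(1)[OF hol(2)] open_ball that]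
    by (rule deriv_add)
  have "weighted_bounded v (deriv (\<lambda>z. f z + h z))"
    using norm_Hv_add(1)[OF bdd] weighted_bounded_cong[OF der] by simp
  then show "(\<lambda>z. f z + h z) \<in> Bv v"
    using hol by (auto simp: Bv_def Hol_disc_def intro!: holomorphic_on_add holomorphic_on_mult holomorphic_on_const)
  have "norm_Hv v (deriv (\<lambda>z. f z + h z)) \<le> norm_Hv v (deriv f) + norm_Hv v (deriv h)"
    using norm_Hv_add(2)[OF bdd] norm_Hv_cong[OF der] by simp
  then show "norm_Bv v (\<lambda>z. f z + h z) \<le> norm_Bv v f + norm_Bv v h"
    using norm_triangle_ineq[of "f 0" "h 0"] by (simp add: norm_Bv_eq)
next
  fix f a assume f: "f \<in> Bv v"
  then have bdd: "weighted_bounded v (deriv f)" and hol: "f \<in> Hol_disc" by (auto simp: Bv_def)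
  have der: "deriv (\<lambda>z. a * f z) z = a * deriv f z" if "z \<in> unit_disc" for z
    using holomorphic_on_imp_differentiable_at[OF Hol_discD(1)[OF hol] open_ball that]
    by (rule deriv_cmult)
  have "weighted_bounded v (deriv (\<lambda>z. a * f z))"
    using norm_Hv_scale(1)[OF bdd, of a] weighted_bounded_cong[OF der] by simp
  then show "(\<lambda>z. a * f z) \<in> Bv v"
    using hol by (auto simp: Bv_def Hol_disc_def intro!: holomorphic_on_add holomorphic_on_mult holomorphic_on_const)
  show "norm_Bv v (\<lambda>z. a * f z) = cmod a * norm_Bv v f"
    using norm_Hv_scale(2)[OF bdd, of a] norm_Hv_cong[OF der]
    by (simp add: norm_Bv_eq norm_mult distrib_left)
  show "0 \<le> norm_Bv v f" using norm_Hv_nonneg[OF bdd] by (simp add: norm_Bv_eq)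
  show "norm_Bv v f = 0 \<longleftrightarrow> f = (\<lambda>z. 0)"
  proof
    assume "norm_Bv v f = 0"
    then have 0: "f 0 = 0" "norm_Hv v (deriv f) = 0"
      using norm_Hv_nonneg[OF bdd] norm_ge_zero[of "f 0"] unfolding norm_Bv_eq
      by (simp_all add: add_nonneg_eq_0_iff)
    have "f z = 0" if z: "z \<in> unit_disc" for z
    proof -
      have "cmod (f z - f 0) \<le> 0 * cmod (z - 0)"
        using norm_Hv_eq_0_imp[OF bdd 0(2)] z
        by (intro holomorphic_increment_bound[of unit_disc] Hol_discD(1)[OF hol]) auto
      then show ?thesis using 0(1) by simp
    qed
    then show "f = (\<lambda>z. 0)" using Hol_discD(2)[OF hol] by fastforce
  qed (simp add: norm_Bv_eq norm_Hv_zero)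
qed

end


section \<open>Normal weights\<close>

text \<open>Geometric decay in steps of length \<open>k\<close> makes the sums \<open>\<Sum>j\<le>n. a n / a j\<close> comparable to a
  geometric series.\<close>

lemma sum_ratio_bounded:
  fixes a :: "nat \<Rightarrow> real"
  assumes pos: "\<And>n. 0 < a n" and dec: "\<And>m n. m \<le> n \<Longrightarrow> a n \<le> a m"
    and q: "q < 1" and decay: "\<And>n. n0 \<le> n \<Longrightarrow> a (n + k) \<le> q * a n"
  obtains S where "0 < S" and "\<And>n. (\<Sum>j\<le>n. a n / a j) \<le> S"
proof -
  have "0 < q * a n0" using decay[of n0] pos[of "n0 + k"] by linarith
  then have q0: "0 < q" using pos[of n0] by (simp add: zero_less_mult_iff)
  have k: "0 < k"
  proof (rule ccontr)
    assume "\<not> 0 < k"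
    then have "a n0 \<le> q * a n0" using decay[of n0] by simp
    then show False using q pos[of n0] by simp
  qed
  have ratio: "a n / a j \<le> 1" if "j \<le> n" for n j
    using dec[OF that] pos[of j] by simp
  \<comment> \<open>the first entry covers the indices below \<open>n0 + k\<close>; the second solves \<open>q * S + k = S\<close>, the induction
    step from \<open>n - k\<close> to \<open>n\<close>\<close>
  define S where "S = max (real (n0 + k)) (k / (1 - q))"
  have "k / (1 - q) \<le> S" by (simp add: S_def)
  then have S: "q * S + k \<le> S" using q by (simp add: pos_divide_le_eq algebra_simps)
  show ?thesis
  proof (rule that[of S])
    show "0 < S" using k by (simp add: S_def)
    fix n show "(\<Sum>j\<le>n. a n / a j) \<le> S"
    proof (induction n rule: less_induct)
      case (less n)
      show ?case
      proof (cases "n < n0 + k")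
        case True
        have "(\<Sum>j\<le>n. a n / a j) \<le> (\<Sum>j\<le>n. 1)" by (intro sum_mono ratio) simp
        also have "\<dots> \<le> real (n0 + k)" using True by simp
        finally show ?thesis by (simp add: S_def)
      next
        case False
        define m where "m = n - k"
        have m: "n = m + k" "n0 \<le> m" "m < n" using False k by (auto simp: m_def)
        have "{..n} = {..m} \<union> {m<..n}" "{..m} \<inter> {m<..n} = {}" using m by auto
        then have "(\<Sum>j\<le>n. a n / a j) = (\<Sum>j\<le>m. a n / a j) + (\<Sum>j\<in>{m<..n}. a n / a j)"
          by (simp add: sum.union_disjoint)
        also have "(\<Sum>j\<le>m. a n / a j) \<le> (\<Sum>j\<le>m. q * (a m / a j))"
          using decay[OF m(2)] pos m(1) by (intro sum_mono) (simp add: divide_right_mono less_imp_le)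
        also have "\<dots> = q * (\<Sum>j\<le>m. a m / a j)" by (simp add: sum_distrib_left)
        also have "\<dots> \<le> q * S" using q0 by (intro mult_left_mono less.IH m(3)) simp
        also have "(\<Sum>j\<in>{m<..n}. a n / a j) \<le> (\<Sum>j\<in>{m<..n}. 1)" by (intro sum_mono ratio) simp
        also have "\<dots> = k" using m(1) by simp
        finally show ?thesis using S by simp
      qed
    qed
  qed
qed

definition shell_radius :: "nat \<Rightarrow> real" where
  "shell_radius n = 1 - 1 / 2 ^ n"

context
  fixes v :: "complex \<Rightarrow> real"
  assumes v: "normal_weight v"
begin

definition shell_weight :: "nat \<Rightarrow> real" where
  "shell_weight n = v (of_real (shell_radius n))"

lemma normal_weight_pos: "z \<in> unit_disc \<Longrightarrow> 0 < v z"
  using v unfolding normal_weight_def weight_def by blast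

lemma normal_weight_antimono:
  "z \<in> unit_disc \<Longrightarrow> z' \<in> unit_disc \<Longrightarrow> cmod z \<le> cmod z' \<Longrightarrow> v z' \<le> v z"
  using v unfolding normal_weight_def by blast

lemma shell_radius_facts: "0 \<le> shell_radius n" "shell_radius n < 1" "shell_radius (Suc n) - shell_radius n = 1 / 2 ^ Suc n"
  "m \<le> n \<Longrightarrow> shell_radius m \<le> shell_radius n" "cmod (of_real (shell_radius n)) = shell_radius n"
proof -
  show "0 \<le> shell_radius n" by (simp add: shell_radius_def field_simps)
  then show "cmod (of_real (shell_radius n)) = shell_radius n" by simp
qed (simp_all add: shell_radius_def field_simps)

lemma shell_radius_in_disc: "of_real (shell_radius n) \<in> unit_disc"
  using shell_radius_facts(2,5)[of n] by simp

lemma shell_weight_pos: "0 < shell_weight n"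
  unfolding shell_weight_def by (rule normal_weight_pos[OF shell_radius_in_disc])

lemma weight_at_radius: "v (1 - 1 / 2 ^ n) = shell_weight n"
  by (simp add: shell_weight_def shell_radius_def)

lemma weight_le_shell_weight: "z \<in> unit_disc \<Longrightarrow> shell_radius n \<le> cmod z \<Longrightarrow> v z \<le> shell_weight n"
  unfolding shell_weight_def by (rule normal_weight_antimono) (simp_all add: shell_radius_in_disc shell_radius_facts(5) del: norm_of_real)

lemma shell_weight_le_weight: "cmod z \<le> shell_radius n \<Longrightarrow> shell_weight n \<le> v z"
  unfolding shell_weight_def
  using shell_radius_facts(2)[of n]
  by (intro normal_weight_antimono) (simp_all add: shell_radius_in_disc shell_radius_facts(5) del: norm_of_real)

lemma shell_containing:
  assumes "z \<in> unit_disc"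
  obtains n where "shell_radius n \<le> cmod z" "cmod z < shell_radius (Suc n)"
proof -
  obtain m where "(1 / 2) ^ m < 1 - cmod z"
    using real_arch_pow_inv[of "1 - cmod z" "1 / 2"] assms by auto
  then have ex: "cmod z < shell_radius m" by (simp add: shell_radius_def power_one_over)
  define l where "l = (LEAST m. cmod z < shell_radius m)"
  have l: "cmod z < shell_radius l" unfolding l_def using ex by (rule LeastI)
  have "l \<noteq> 0"
  proof
    assume "l = 0"
    then show False using l by (simp add: shell_radius_def)
  qed
  then obtain n where n: "l = Suc n" by (cases l) auto
  have "\<not> cmod z < shell_radius n" unfolding l_def[symmetric] using not_less_Least[of n "\<lambda>m. cmod z < shell_radius m"] n l_def by simp
  then show ?thesis using that[of n] l n by simp
qed

lemma normal_weight_doubling: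
  obtains \<Delta> where "0 < \<Delta>" and "\<And>n. shell_weight n \<le> \<Delta> * shell_weight (Suc n)"
proof -
  let ?s = "SUP n::nat. ennreal (v (1 - 1 / 2 ^ n) / v (1 - 1 / 2 ^ (n + 1)))"
  have "?s < top" using v unfolding normal_weight_def infinity_ennreal_def by blast
  then obtain t where t: "0 \<le> t" "?s = ennreal t" unfolding less_top_ennreal by blast
  have ratio: "shell_weight n / shell_weight (Suc n) \<le> t" for n
  proof -
    have "ennreal (v (1 - 1 / 2 ^ n) / v (1 - 1 / 2 ^ (n + 1))) \<le> ?s" by (rule SUP_upper) simp
    also note t(2)
    finally have "ennreal (shell_weight n / shell_weight (Suc n)) \<le> ennreal t"
      unfolding weight_at_radius by simp
    then show ?thesis using t(1) by (simp add: ennreal_le_iff)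
  qed
  show ?thesis
  proof (rule that[of "t + 1"])
    show "0 < t + 1" using t by simp
    show "shell_weight n \<le> (t + 1) * shell_weight (Suc n)" for n
      using ratio[of n] shell_weight_pos[of "Suc n"] by (simp add: pos_divide_le_eq distrib_right)
  qed
qed

lemma normal_weight_sum_bounded:
  obtains S where "0 < S" and "\<And>n. (\<Sum>j\<le>n. shell_weight n / shell_weight j) \<le> S"
proof -
  have "(INF k::nat. limsup (\<lambda>n. ennreal (v (1 - 1 / 2 ^ (n + k)) / v (1 - 1 / 2 ^ n)))) < 1"
    using v unfolding normal_weight_def by blast
  then obtain k where "limsup (\<lambda>n. ennreal (shell_weight (n + k) / shell_weight n)) < 1"
    unfolding INF_less_iff weight_at_radius by blast
  then obtain y where y: "limsup (\<lambda>n. ennreal (shell_weight (n + k) / shell_weight n)) < y" "y < 1"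
    using dense by blast
  from y(2) have "y < top" by (rule less_trans) simp
  then obtain q where q: "0 \<le> q" "y = ennreal q" unfolding less_top_ennreal by blast
  have "\<forall>\<^sub>F n in sequentially. ennreal (shell_weight (n + k) / shell_weight n) < ennreal q"
    using y(1) unfolding q(2) by (rule Limsup_lessD)
  then obtain n0 where n0: "\<And>n. n0 \<le> n \<Longrightarrow> ennreal (shell_weight (n + k) / shell_weight n) < ennreal q"
    unfolding eventually_sequentially by blast
  have "shell_weight (n + k) \<le> q * shell_weight n" if "n0 \<le> n" for n
  proof -
    have "shell_weight (n + k) / shell_weight n < q"
      using n0[OF that] shell_weight_pos[of n] shell_weight_pos[of "n + k"]
      by (simp add: ennreal_less_iff)
    then show ?thesis using shell_weight_pos[of n] by (simp add: pos_divide_less_eq)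
  qed
  moreover have "q < 1" using y(2) q by (simp add: ennreal_less_one_iff)
  moreover have "shell_weight n \<le> shell_weight m" if "m \<le> n" for m n
    using that by (intro shell_weight_le_weight[of "of_real (shell_radius m)" n, folded shell_weight_def]) (simp only: shell_radius_facts)
  ultimately show ?thesis
    using sum_ratio_bounded[of shell_weight q n0 k] shell_weight_pos that by metis
qed

text \<open>Cauchy's estimate on the disc of radius \<open>(1 - |z|) / 2\<close> about \<open>z\<close>. That disc reaches at most one
  shell further than \<open>z\<close>, so by doubling the weight on it is at least a fixed multiple of \<open>v z\<close>.\<close>

lemma weighted_deriv_le_norm_Hv:
  obtains A where "0 < A"
    and "\<And>h z. h \<in> Hv v \<Longrightarrow> z \<in> unit_disc \<Longrightarrow> (1 - cmod z) * v z * cmod (deriv h z) \<le> A * norm_Hv v h"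
proof -
  obtain \<Delta> where \<Delta>: "0 < \<Delta>" "\<And>n. shell_weight n \<le> \<Delta> * shell_weight (Suc n)" by (rule normal_weight_doubling) blast
  show ?thesis
  proof (rule that[of "2 * \<Delta>\<^sup>2"])
    show "0 < 2 * \<Delta>\<^sup>2" using \<Delta> by simp
    fix h z assume h: "h \<in> Hv v" and z: "z \<in> unit_disc"
    then have hol: "h holomorphic_on unit_disc" and bdd: "weighted_bounded v h"
      by (auto simp: Hv_def Hol_disc_def)
    define \<delta> where "\<delta> = (1 - cmod z) / 2"
    have \<delta>: "0 < \<delta>" using z by (simp add: \<delta>_def)
    have vz: "0 < v z" by (rule normal_weight_pos[OF z])
    obtain n where n: "shell_radius n \<le> cmod z" "cmod z < shell_radius (Suc n)" by (rule shell_containing[OF z])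
    have near: "cmod x \<le> shell_radius (Suc (Suc n))" if "x \<in> cball z \<delta>" for x
    proof -
      have "cmod x \<le> cmod z + \<delta>"
        using that norm_triangle_sub[of x z] by (simp add: dist_norm norm_minus_commute)
      also have "\<dots> = (1 + cmod z) / 2" by (simp add: \<delta>_def field_simps)
      also have "\<dots> \<le> (1 + shell_radius (Suc n)) / 2" using n(2) by simp
      also have "\<dots> = shell_radius (Suc (Suc n))" by (simp add: shell_radius_def field_simps)
      finally show ?thesis .
    qed
    have sub: "cball z \<delta> \<subseteq> unit_disc"
      using near shell_radius_facts(2) by (force intro: le_less_trans)
    have "cmod (h x) \<le> norm_Hv v h * \<Delta>\<^sup>2 / v z" if x: "x \<in> cball z \<delta>" for x
    proof -
      have "v z \<le> shell_weight n" by (rule weight_le_shell_weight[OF z n(1)])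
      also have "\<dots> \<le> \<Delta> * shell_weight (Suc n)" by (rule \<Delta>(2))
      also have "\<dots> \<le> \<Delta> * (\<Delta> * shell_weight (Suc (Suc n)))" using \<Delta> by (intro mult_left_mono) auto
      also have "\<dots> \<le> \<Delta> * (\<Delta> * v x)"
        using \<Delta>(1) shell_weight_le_weight[OF near[OF x]] by (intro mult_left_mono) auto
      finally have "v z * cmod (h x) \<le> \<Delta> * (\<Delta> * v x) * cmod (h x)" by (rule mult_right_mono) simp
      also have "\<dots> = \<Delta>\<^sup>2 * (v x * cmod (h x))" by (simp add: power2_eq_square)
      also have "\<dots> \<le> \<Delta>\<^sup>2 * norm_Hv v h"
        using sub x by (intro mult_left_mono norm_Hv_upper[OF bdd]) auto
      finally show ?thesis using vz by (simp add: field_simps)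
    qed
    then have "cmod (deriv h z) \<le> norm_Hv v h * \<Delta>\<^sup>2 / v z / \<delta>"
      by (rule deriv_bound_on_cball[OF hol sub \<delta>])
    then have "\<delta> * v z * cmod (deriv h z) \<le> norm_Hv v h * \<Delta>\<^sup>2"
      using vz \<delta> by (simp add: field_simps)
    then show "(1 - cmod z) * v z * cmod (deriv h z) \<le> 2 * \<Delta>\<^sup>2 * norm_Hv v h"
      by (simp add: \<delta>_def mult.commute)
  qed
qed

text \<open>A dyadic shell is as wide as its distance \<open>d\<close> from the circle, and up to its outer radius the
  derivative is at most \<open>S / d\<close> over the weight there. Crossing the shell therefore adds at most \<open>S\<close> over
  the weight at its outer radius, whatever \<open>d\<close> is.\<close>

lemma dyadic_growth:
  assumes hol: "h holomorphic_on unit_disc" and S: "0 \<le> S"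
    and le: "\<And>z. z \<in> unit_disc \<Longrightarrow> (1 - cmod z) * v z * cmod (deriv h z) \<le> S"
    and z: "cmod z \<le> shell_radius n"
  shows "cmod (h z) \<le> cmod (h 0) + S * (\<Sum>j<n. 1 / shell_weight (Suc j))"
  using z
proof (induction n arbitrary: z)
  case 0
  then show ?case by (simp add: shell_radius_def)
next
  case (Suc n)
  let ?r = "shell_radius (Suc n)" and ?C = "S / (1 / 2 ^ Suc n * shell_weight (Suc n))"
  \<comment> \<open>the point on the segment from \<open>0\<close> to \<open>z\<close> where the last shell is entered\<close>
  obtain y where y: "cmod y \<le> shell_radius n" "cmod (z - y) \<le> 1 / 2 ^ Suc n"
  proof (cases "cmod z \<le> shell_radius n")
    case True
    then show ?thesis using that[of z] by simp
  next
    case False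
    then have z0: "0 < cmod z" using shell_radius_facts(1)[of n] by linarith
    let ?y = "of_real (shell_radius n / cmod z) * z"
    have "z - ?y = of_real (1 - shell_radius n / cmod z) * z" by (simp add: algebra_simps)
    also have "cmod \<dots> = \<bar>1 - shell_radius n / cmod z\<bar> * cmod z" by (simp only: norm_mult norm_of_real)
    also have "\<dots> = cmod z - shell_radius n" using False z0 by (simp add: field_simps abs_if)
    also have "\<dots> \<le> 1 / 2 ^ Suc n" using Suc.prems shell_radius_facts(3)[of n] by linarith
    finally have "cmod (z - ?y) \<le> 1 / 2 ^ Suc n" .
    moreover have "cmod ?y \<le> shell_radius n"
      using z0 shell_radius_facts(1)[of n] by (simp add: norm_mult norm_divide)
    ultimately show ?thesis using that by blast
  qed
  have "cmod (h z - h y) \<le> ?C * cmod (z - y)"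
  proof (rule holomorphic_increment_bound[of "cball 0 ?r"])
    show "cball 0 ?r \<subseteq> unit_disc" using shell_radius_facts(2)[of "Suc n"] by auto
    show "z \<in> cball 0 ?r" "y \<in> cball 0 ?r"
      using Suc.prems y(1) shell_radius_facts(4)[of n "Suc n"] by auto
    fix x :: complex assume "x \<in> cball 0 ?r"
    then have x: "cmod x \<le> ?r" by simp
    then have xd: "x \<in> unit_disc" using shell_radius_facts(2)[of "Suc n"] by simp
    have "1 / 2 ^ Suc n \<le> 1 - cmod x" using x by (simp add: shell_radius_def)
    then have "1 / 2 ^ Suc n * shell_weight (Suc n) \<le> (1 - cmod x) * v x"
      using shell_weight_le_weight[OF x] shell_weight_pos[of "Suc n"] xd by (intro mult_mono) auto
    then have "1 / 2 ^ Suc n * shell_weight (Suc n) * cmod (deriv h x) \<le> (1 - cmod x) * v x * cmod (deriv h x)"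
      by (rule mult_right_mono) simp
    also note le[OF xd]
    finally show "cmod (deriv h x) \<le> ?C"
      using shell_weight_pos[of "Suc n"] by (simp add: field_simps)
  qed (simp_all add: hol)
  also have "\<dots> \<le> ?C * (1 / 2 ^ Suc n)"
    using y(2) S shell_weight_pos[of "Suc n"] by (intro mult_left_mono) auto
  also have "\<dots> = S * (1 / shell_weight (Suc n))" by simp
  finally have "cmod (h z) \<le> cmod (h y) + S * (1 / shell_weight (Suc n))"
    using norm_triangle_sub[of "h z" "h y"] by linarith
  then show ?case using Suc.IH[OF y(1)] by (simp add: distrib_left)
qed

text \<open>The reciprocal weights collected on the way out to \<open>z\<close> form a sum that is dominated by its last
  term, and doubling compares that term with \<open>1 / v z\<close>.\<close>

lemma norm_Hv_le_weighted_deriv: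
  obtains B where "0 < B"
    and "\<And>h S. h \<in> Hv v \<Longrightarrow> 0 \<le> S \<Longrightarrow>
      (\<And>z. z \<in> unit_disc \<Longrightarrow> (1 - cmod z) * v z * cmod (deriv h z) \<le> S) \<Longrightarrow>
      norm_Hv v h \<le> B * (cmod (h 0) + S)"
proof -
  obtain \<Delta> where \<Delta>: "0 < \<Delta>" "\<And>n. shell_weight n \<le> \<Delta> * shell_weight (Suc n)" by (rule normal_weight_doubling) blast
  obtain C where C: "0 < C" "\<And>n. (\<Sum>j\<le>n. shell_weight n / shell_weight j) \<le> C" by (rule normal_weight_sum_bounded) blast
  show ?thesis
  proof (rule that[of "v 0 + \<Delta> * C"])
    have v0: "0 < v 0" by (rule normal_weight_pos) simp
    then show "0 < v 0 + \<Delta> * C" using \<Delta> C by (simp add: add_pos_pos)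
    fix h S assume h: "h \<in> Hv v" and S: "0 \<le> (S::real)"
      and le: "\<And>z. z \<in> unit_disc \<Longrightarrow> (1 - cmod z) * v z * cmod (deriv h z) \<le> S"
    have hol: "h holomorphic_on unit_disc" using h by (simp add: Hv_def Hol_disc_def)
    show "norm_Hv v h \<le> (v 0 + \<Delta> * C) * (cmod (h 0) + S)"
    proof (rule norm_Hv_least)
      fix z assume z: "z \<in> unit_disc"
      obtain n where n: "shell_radius n \<le> cmod z" "cmod z < shell_radius (Suc n)" by (rule shell_containing[OF z])
      let ?s = "\<Sum>j<Suc n. 1 / shell_weight (Suc j)"
      have s0: "0 \<le> ?s" using shell_weight_pos by (intro sum_nonneg) (simp add: less_imp_le)
      have vz: "v z \<le> \<Delta> * shell_weight (Suc n)" using weight_le_shell_weight[OF z n(1)] \<Delta>(2)[of n] by linarith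
      have "shell_weight (Suc n) * ?s = (\<Sum>j<Suc n. shell_weight (Suc n) / shell_weight (Suc j))"
        by (simp only: sum_distrib_left times_divide_eq_right mult_1_right)
      also have "\<dots> \<le> shell_weight (Suc n) / shell_weight 0 + (\<Sum>j<Suc n. shell_weight (Suc n) / shell_weight (Suc j))"
        using shell_weight_pos[of 0] shell_weight_pos[of "Suc n"] by simp
      also have "\<dots> = (\<Sum>j\<le>Suc n. shell_weight (Suc n) / shell_weight j)"
        by (simp only: lessThan_Suc_atMost[symmetric] sum.lessThan_Suc_shift)
      also note C(2)
      finally have as: "shell_weight (Suc n) * ?s \<le> C" .
      have "v z * cmod (h z) \<le> v z * (cmod (h 0) + S * ?s)"
        using dyadic_growth[OF hol S le, of z "Suc n"] n(2) normal_weight_pos[OF z]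
        by (intro mult_left_mono) auto
      also have "\<dots> = v z * cmod (h 0) + v z * (S * ?s)" by (rule distrib_left)
      also have "\<dots> \<le> v 0 * cmod (h 0) + \<Delta> * shell_weight (Suc n) * (S * ?s)"
        using vz S s0 normal_weight_antimono[of 0 z] z
        by (intro add_mono mult_right_mono mult_nonneg_nonneg) auto
      also have "\<Delta> * shell_weight (Suc n) * (S * ?s) = \<Delta> * S * (shell_weight (Suc n) * ?s)" by simp
      also have "\<dots> \<le> \<Delta> * S * C" using as \<Delta> S by (intro mult_left_mono) auto
      also have "v 0 * cmod (h 0) + \<Delta> * S * C \<le> (v 0 + \<Delta> * C) * (cmod (h 0) + S)"
        using v0 \<Delta> C S by (simp add: algebra_simps)
      finally show "v z * cmod (h z) \<le> (v 0 + \<Delta> * C) * (cmod (h 0) + S)" by simp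
    qed
  qed
qed

end


section \<open>The two target spaces\<close>

theorem theorem3p7:
  fixes X :: "(complex \<Rightarrow> complex) set"
    and N :: "(complex \<Rightarrow> complex) \<Rightarrow> real"
  assumes "banach_space_on_disc X N"
    and "\<forall>a. on_disc (\<lambda>z. a) \<in> X"
    and "condI X N" and "condII X N" and "condIII X N" and "condIV X N" and "condV X N"
  shows
    "(\<forall>v. normal_weight v \<longrightarrow>
       (\<exists>c>0. \<forall>g \<phi>.
          g holomorphic_on unit_disc \<and> \<phi> holomorphic_on unit_disc \<and> \<phi> ` unit_disc \<subseteq> unit_disc \<and>
          bounded_operator X N (Hv v) (norm_Hv v) (volterra g \<phi>) \<longrightarrow>
          comparable c
            (essential_norm X N (Hv v) (norm_Hv v) (volterra g \<phi>))
            (limsup_circle \<phi> (\<lambda>z.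
               ennreal ((1 - cmod z) * v z * cmod (deriv (g \<circ> \<phi>) z)) * eval_norm X N (\<phi> z))))) \<and>
     (\<forall>v. weight v \<longrightarrow>
       (\<exists>c>0. \<forall>g \<phi>.
          g holomorphic_on unit_disc \<and> \<phi> holomorphic_on unit_disc \<and> \<phi> ` unit_disc \<subseteq> unit_disc \<and>
          bounded_operator X N (Bv v) (norm_Bv v) (volterra g \<phi>) \<longrightarrow>
          comparable c
            (essential_norm X N (Bv v) (norm_Bv v) (volterra g \<phi>))
            (limsup_circle \<phi> (\<lambda>z.
               ennreal (v z * cmod (deriv (g \<circ> \<phi>) z)) * eval_norm X N (\<phi> z)))))"
proof -
  have X: "normed_space_on_disc X N" using assms(1) by (simp add: banach_space_on_disc_def)
  have one: "on_disc (\<lambda>z. 1) \<in> X" using assms(2) by blast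
  let ?s = "SUP r\<in>{0<..<1}. op_norm X N N (dilation r)"
  have "?s < top" using assms(6) by (simp add: condIV_def)
  then obtain t where t: "0 \<le> t" "?s = ennreal t" unfolding less_top_ennreal by blast
  \<comment> \<open>any upper bound of the dilation norms that is positive\<close>
  define D where "D = t + 1"
  have D0: "0 < D" using t by (simp add: D_def)
  have D: "op_norm X N N (dilation r) \<le> ennreal D" if "0 < r" "r < 1" for r
  proof -
    have "op_norm X N N (dilation r) \<le> ?s" using that by (intro SUP_upper) simp
    also have "\<dots> \<le> ennreal D" unfolding t(2) D_def by (rule ennreal_leI) simp
    finally show ?thesis .
  qed
  show ?thesis
  proof (intro conjI allI impI)
    fix v assume nv: "normal_weight v"
    obtain A where A: "0 < A" "\<And>h z. h \<in> Hv v \<Longrightarrow> z \<in> unit_disc \<Longrightarrow>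
        (1 - cmod z) * v z * cmod (deriv h z) \<le> A * norm_Hv v h"
      by (rule weighted_deriv_le_norm_Hv[OF nv]) blast
    obtain B where B: "0 < B" "\<And>h S. h \<in> Hv v \<Longrightarrow> 0 \<le> S \<Longrightarrow>
        (\<And>z. z \<in> unit_disc \<Longrightarrow> (1 - cmod z) * v z * cmod (deriv h z) \<le> S) \<Longrightarrow>
        norm_Hv v h \<le> B * (cmod (h 0) + S)"
      by (rule norm_Hv_le_weighted_deriv[OF nv]) blast
    note vpos = normal_weight_pos[OF nv]
    show "\<exists>c>0. \<forall>g \<phi>.
        g holomorphic_on unit_disc \<and> \<phi> holomorphic_on unit_disc \<and> \<phi> ` unit_disc \<subseteq> unit_disc \<and>
        bounded_operator X N (Hv v) (norm_Hv v) (volterra g \<phi>) \<longrightarrow>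
        comparable c (essential_norm X N (Hv v) (norm_Hv v) (volterra g \<phi>))
          (limsup_circle \<phi> (\<lambda>z.
             ennreal ((1 - cmod z) * v z * cmod (deriv (g \<circ> \<phi>) z)) * eval_norm X N (\<phi> z)))"
    proof (intro exI[of _ "B * (1 + D) + 2 * A * D"] conjI allI impI; (elim conjE)?)
      show "0 < B * (1 + D) + 2 * A * D" using A(1) B(1) D0 by (simp add: add_pos_pos)
      fix g \<phi> assume g: "g holomorphic_on unit_disc"
        and \<phi>: "\<phi> holomorphic_on unit_disc" "\<phi> ` unit_disc \<subseteq> unit_disc"
        and T: "bounded_operator X N (Hv v) (norm_Hv v) (volterra g \<phi>)"
      interpret volterra_into_derivative_norm X "Hv v" N "norm_Hv v" "\<lambda>z. (1 - cmod z) * v z" A B D g \<phi>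
        by unfold_locales
          (use X one assms normed_space_Hv[of v] vpos A B D D0 g \<phi> T in \<open>auto simp: less_imp_le\<close>)
      show "comparable (B * (1 + D) + 2 * A * D)
          (essential_norm X N (Hv v) (norm_Hv v) (volterra g \<phi>))
          (limsup_circle \<phi> (\<lambda>z.
             ennreal ((1 - cmod z) * v z * cmod (deriv (g \<circ> \<phi>) z)) * eval_norm X N (\<phi> z)))"
        using essential_norm_comparable unfolding density_def symbol_def .
    qed
  next
    fix v assume wv: "weight v"
    have vpos: "0 < v z" if "z \<in> unit_disc" for z using wv that by (simp add: weight_def)
    have normed: "normed_space_on_disc (Bv v) (norm_Bv v)" by (rule normed_space_Bv) (rule vpos)
    have deriv_le: "v z * cmod (deriv h z) \<le> 1 * norm_Bv v h"
      if "h \<in> Bv v" "z \<in> unit_disc" for h z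
      using norm_Hv_upper[of v "deriv h" z] that
      by (simp add: Bv_def norm_Bv_eq add_increasing)
    have le_deriv: "norm_Bv v h \<le> 1 * (cmod (h 0) + S)"
      if "h \<in> Bv v" "0 \<le> S" "\<And>z. z \<in> unit_disc \<Longrightarrow> v z * cmod (deriv h z) \<le> S" for h S
      using norm_Hv_least[of v "deriv h" S] that by (simp add: norm_Bv_eq)
    show "\<exists>c>0. \<forall>g \<phi>.
        g holomorphic_on unit_disc \<and> \<phi> holomorphic_on unit_disc \<and> \<phi> ` unit_disc \<subseteq> unit_disc \<and>
        bounded_operator X N (Bv v) (norm_Bv v) (volterra g \<phi>) \<longrightarrow>
        comparable c (essential_norm X N (Bv v) (norm_Bv v) (volterra g \<phi>))
          (limsup_circle \<phi> (\<lambda>z. ennreal (v z * cmod (deriv (g \<circ> \<phi>) z)) * eval_norm X N (\<phi> z)))"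
    proof (intro exI[of _ "1 * (1 + D) + 2 * 1 * D"] conjI allI impI; (elim conjE)?)
      show "0 < 1 * (1 + D) + 2 * 1 * D" using D0 by simp
      fix g \<phi> assume g: "g holomorphic_on unit_disc"
        and \<phi>: "\<phi> holomorphic_on unit_disc" "\<phi> ` unit_disc \<subseteq> unit_disc"
        and T: "bounded_operator X N (Bv v) (norm_Bv v) (volterra g \<phi>)"
      interpret volterra_into_derivative_norm X "Bv v" N "norm_Bv v" v 1 1 D g \<phi>
        by (rule volterra_into_derivative_norm.intro)
          (fact X normed one assms D D0 vpos[THEN less_imp_le] deriv_le le_deriv
            zero_less_one g \<phi> T)+
      show "comparable (1 * (1 + D) + 2 * 1 * D)
          (essential_norm X N (Bv v) (norm_Bv v) (volterra g \<phi>))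
          (limsup_circle \<phi> (\<lambda>z. ennreal (v z * cmod (deriv (g \<circ> \<phi>) z)) * eval_norm X N (\<phi> z)))"
        using essential_norm_comparable unfolding density_def symbol_def .
    qed
  qed
qed

end
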